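(* Let $s\in\mathcal S(n+1)$ for some $n\in\omega$, let $M_0,\dots,M_{\ell(s)-1}$ be uniform chains of rank $\omega$, and suppose the chain $A=\mathcal A(s)[M_0,\dots,M_{\ell(s)-1}]$ is uniform. Then (a) $\mathrm f M_i\cong\mathrm f M_j$ for all $i,j<\ell(s)$, and (b) $M_i\cong M_j$ whenever $i,j<\ell(s)$ and $\mathrm{wt}^s(i)=\mathrm{wt}^s(j)$.
   Context: A chain is a linearly ordered set; $\cong$ is order isomorphism. $A+B$ and $\sum_{i\in I}A_i$ are ordered sums, $AB=\sum_{b\in B}A$ is the anti-lexicographically ordered product; $\mathbb N,\mathbb Z$ have their usual orders and $1$ is the one-element chain. For a chain $A$ define convex equivalence relations $\rho_\alpha$ ($\alpha$ an ordinal): $\rho_0$ is equality; $A/\alpha$ is the quotient chain of $\rho_\alpha$-classes and $[x]_\alpha$ is the class of $x$; $x\rho_{\alpha+1}y$ iff the interval between $[x]_\alpha$ and $[y]_\alpha$ in $A/\alpha$ is finite; for limit $\alpha$, $x\rho_\alpha y$ iff $x\rho_\beta y$ for some $\beta<\alpha$. The rank $\mathrm{rk}(A)$ is the least $\alpha$ with $A/\alpha\cong 1$. All chains are assumed decomposable (their rank is defined). $A$ is uniform if $A^{\ge x}=\{y\in A:x\le y\}$ has the same order type for all $x\in A$; then $\mathrm f A$ denotes this common tail. $\mathcal S(m)$ is the set of sequences $s=(s(0),\dots,s(m-1))$ of natural numbers with $s(i)\le i$ for all $i<m$; $|s|=m$. For $s$ of length $n+1\ge2$: $s^-$ is $s$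 with its last entry deleted, and $s^+$ is $s$ with its next-to-last entry $s(n-1)$ deleted; $s^+\in\mathcal S(n)$ iff $s(n)<n$. The tree of $s$ (nonempty) has root $(s;0)$; a node $(t;k)$ with $|t|=m+1\ge 2$ has the single child $(t^-;0)$ if $t(m)=m$, and a left child $(t^+;k+1)$ and a right child $(t^-;0)$ if $t(m)<m$. The leaves are the nodes $(\langle 0\rangle;k)$ on level $|s|-1$, ordered from left to right; $\ell(s)$ is their number and $\mathrm{wt}^s(i)=k$ if the $i$th leaf ($0\le i<\ell(s)$) is $(\langle0\rangle;k)$. For uniform chains $M_i$ of rank $\omega$: $\mathcal A(\langle0\rangle)[M_0]=M_0$, and for $s$ of length $n+1\ge 2$, $\mathcal A(s)[M_0,\dots,M_{\ell(s)-1}]=\mathcal A(s^-)[M_0,\dots,M_{\ell(s^-)-1}]\,\mathbb Z$ if $s(n)=n$ (then $\ell(s)=\ell(s^-)$), and $=\mathcal A(s^+)[M_0,\dots,M_{\ell(s^+)-1}]+\mathcal A(s^-)[M_{\ell(s^+)},\dots,M_{\ell(s)-1}]\,\mathbb N$ if $s(n)<n$ (then $\ell(s)=\ell(s^+)+\ell(s^-)$). *)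

theory Defs
  imports "HOL-Library.Extended_Nat"
begin

section \<open>Chains\<close>

text \<open>A chain is a reflexive relation \<open>A\<close> with \<open>Linear_order A\<close>; its carrier is \<open>Field A\<close>.\<close>

abbreviation chain :: "'a rel \<Rightarrow> bool" where
  "chain A \<equiv> Linear_order A"

definition order_iso :: "'a rel \<Rightarrow> 'b rel \<Rightarrow> bool"  (infix \<open>\<cong>\<^sub>o\<close> 50) where
  "A \<cong>\<^sub>o B \<longleftrightarrow> (\<exists>f. iso A B f)"

lemma order_iso_iff:
  "A \<cong>\<^sub>o B \<longleftrightarrow> (\<exists>f. bij_betw f (Field A) (Field B) \<and>
     (\<forall>x\<in>Field A. \<forall>y\<in>Field A. (x, y) \<in> A \<longleftrightarrow> (f x, f y) \<in> B))"
  unfolding order_iso_def iso_iff2 ..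

definition one_chain :: "unit rel" where
  "one_chain = {((), ())}"

definition nat_chain :: "nat rel" where
  "nat_chain = {(m, n). m \<le> n}"

definition int_chain :: "int rel" where
  "int_chain = {(m, n). m \<le> n}"

definition chain_plus :: "'a rel \<Rightarrow> 'b rel \<Rightarrow> ('a + 'b) rel" where
  "chain_plus A B =
     {(Inl x, Inl y) | x y. (x, y) \<in> A} \<union>
     {(Inr x, Inr y) | x y. (x, y) \<in> B} \<union>
     {(Inl x, Inr y) | x y. x \<in> Field A \<and> y \<in> Field B}"

definition chain_sum :: "'i rel \<Rightarrow> ('i \<Rightarrow> 'a rel) \<Rightarrow> ('a \<times> 'i) rel" where
  "chain_sum I A = {((x, i), (y, j)) | x i y j.
     i \<in> Field I \<and> j \<in> Field I \<and> x \<in> Field (A i) \<and> y \<in> Field (A j) \<and>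
     (i \<noteq> j \<and> (i, j) \<in> I \<or> i = j \<and> (x, y) \<in> A i)}"

definition chain_times :: "'a rel \<Rightarrow> 'b rel \<Rightarrow> ('a \<times> 'b) rel" where
  "chain_times A B = chain_sum B (\<lambda>_. A)"


section \<open>Condensations and rank\<close>

text \<open>The order on the quotient of \<open>A\<close> by a convex equivalence relation \<open>E\<close>.\<close>

definition quotient_chain :: "'a rel \<Rightarrow> 'a rel \<Rightarrow> 'a set rel" where
  "quotient_chain A E =
     {(X, Y). X \<in> Field A // E \<and> Y \<in> Field A // E \<and> (\<exists>x\<in>X. \<exists>y\<in>Y. (x, y) \<in> A)}"

definition interval_between :: "'a rel \<Rightarrow> 'a \<Rightarrow> 'a \<Rightarrow> 'a set" where
  "interval_between A x y =
     {z \<in> Field A. (x, z) \<in> A \<and> (z, y) \<in> A \<or> (y, z) \<in> A \<and> (z, x) \<in> A}"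

definition condense :: "'a rel \<Rightarrow> 'a rel \<Rightarrow> 'a rel" where
  "condense A E = {(x, y). x \<in> Field A \<and> y \<in> Field A \<and>
     finite (interval_between (quotient_chain A E) (E `` {x}) (E `` {y}))}"

text \<open>Ordinals are represented as elements of an arbitrary well-ordered type \<open>'o\<close>, an element
  standing for the order type of the set of its predecessors.\<close>

definition is_succ_of :: "'o::wellorder \<Rightarrow> 'o \<Rightarrow> bool" where
  "is_succ_of \<alpha> \<beta> \<longleftrightarrow> \<beta> < \<alpha> \<and> (\<forall>\<gamma>. \<beta> < \<gamma> \<longrightarrow> \<alpha> \<le> \<gamma>)"

lemma is_succ_of_unique:
  fixes \<alpha> :: "'o::wellorder"
  shows "is_succ_of \<alpha> \<beta> \<Longrightarrow> is_succ_of \<alpha> \<gamma> \<Longrightarrow> \<beta> = \<gamma>"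
  unfolding is_succ_of_def by (meson leD linorder_less_linear)

lemma is_succ_of_the:
  fixes \<alpha> :: "'o::wellorder"
  assumes "is_succ_of \<alpha> \<beta>"
  shows "(THE \<beta>. is_succ_of \<alpha> \<beta>) = \<beta>"
  using assms is_succ_of_unique by blast

function \<rho> :: "'a rel \<Rightarrow> 'o::wellorder \<Rightarrow> 'a rel" where
  "\<rho> A \<alpha> =
     (if \<forall>\<beta>. \<alpha> \<le> \<beta> then Id_on (Field A)
      else if \<exists>\<beta>. is_succ_of \<alpha> \<beta> then condense A (\<rho> A (THE \<beta>. is_succ_of \<alpha> \<beta>))
      else (\<Union>\<beta>\<in>{..<\<alpha>}. \<rho> A \<beta>))"
  by pat_completeness auto
termination
proof (relation "inv_image {(\<beta> :: 'o::wellorder, \<alpha>). \<beta> < \<alpha>} snd")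
  show "wf (inv_image {(\<beta> :: 'o::wellorder, \<alpha>). \<beta> < \<alpha>} snd)"
    by (intro wf_inv_image wf)
qed (auto simp: is_succ_of_the, auto simp: is_succ_of_def)

declare \<rho>.simps [simp del]

definition quot_level :: "'a rel \<Rightarrow> 'o::wellorder \<Rightarrow> 'a set rel" where
  "quot_level A \<alpha> = quotient_chain A (\<rho> A \<alpha>)"

definition has_rank :: "'a rel \<Rightarrow> 'o::wellorder \<Rightarrow> bool" where
  "has_rank A \<alpha> \<longleftrightarrow>
     quot_level A \<alpha> \<cong>\<^sub>o one_chain \<and> (\<forall>\<beta><\<alpha>. \<not> quot_level A \<beta> \<cong>\<^sub>o one_chain)"

text \<open>In \<^typ>\<open>enat\<close> the predecessors of \<open>\<infinity>\<close> are the natural numbers, so \<open>\<infinity>\<close> is \<open>\<omega>\<close>.\<close>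

definition has_rank_omega :: "'a rel \<Rightarrow> bool" where
  "has_rank_omega A \<longleftrightarrow> has_rank A (\<infinity> :: enat)"

lemma \<rho>_enat_0: "\<rho> A (0 :: enat) = Id_on (Field A)"
  by (subst \<rho>.simps) simp

lemma \<rho>_enat_Suc: "\<rho> A (enat (Suc n)) = condense A (\<rho> A (enat n))"
proof -
  have s: "is_succ_of (enat (Suc n)) (enat n)"
    by (auto simp: is_succ_of_def eSuc_enat[symmetric] ileI1)
  then have "\<not> (\<forall>\<beta>. enat (Suc n) \<le> \<beta>)"
    unfolding is_succ_of_def using leD by blast
  with s show ?thesis
    by (subst \<rho>.simps) (auto simp: is_succ_of_the[OF s])
qed

lemma \<rho>_enat_infinity: "\<rho> A (\<infinity> :: enat) = (\<Union>n. \<rho> A (enat n))"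
proof -
  have "\<not> is_succ_of \<infinity> \<beta>" for \<beta> :: enat
  proof
    assume a: "is_succ_of \<infinity> \<beta>"
    then obtain k where "\<beta> = enat k" by (auto simp: is_succ_of_def)
    moreover from a have "enat k < enat (Suc k) \<longrightarrow> \<infinity> \<le> enat (Suc k)"
      using \<open>\<beta> = enat k\<close> unfolding is_succ_of_def by blast
    ultimately show False by simp
  qed
  moreover have "\<not> (\<forall>\<beta>. (\<infinity> :: enat) \<le> \<beta>)"
    using enat_ord_simps(5) by (auto intro: exI[of _ 0])
  moreover have "{..<\<infinity>} = range enat"
    by (auto simp: less_infinityE elim: less_infinityE)
  ultimately show ?thesis
    by (subst \<rho>.simps) auto
qed


section \<open>Uniform chains\<close>

definition tail :: "'a rel \<Rightarrow> 'a \<Rightarrow> 'a rel" where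
  "tail A x = Restr A (above A x)"

definition uniform :: "'a rel \<Rightarrow> bool" where
  "uniform A \<longleftrightarrow> (\<forall>x\<in>Field A. \<forall>y\<in>Field A. tail A x \<cong>\<^sub>o tail A y)"

text \<open>For uniform \<open>A\<close> the order type of \<open>common_tail A\<close> does not depend on the chosen point.\<close>

definition common_tail :: "'a rel \<Rightarrow> 'a rel" where
  "common_tail A = tail A (SOME x. x \<in> Field A)"


section \<open>Sequences and their trees\<close>

definition \<S> :: "nat \<Rightarrow> nat list set" where
  "\<S> m = {s. length s = m \<and> (\<forall>i<m. s ! i \<le> i)}"

definition seq_minus :: "nat list \<Rightarrow> nat list" where
  "seq_minus s = butlast s"

definition seq_plus :: "nat list \<Rightarrow> nat list" where
  "seq_plus s = butlast (butlast s) @ [last s]"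

lemma seq_minus_in: "s \<in> \<S> (Suc n) \<Longrightarrow> seq_minus s \<in> \<S> n"
  by (auto simp: \<S>_def seq_minus_def nth_butlast)

lemma seq_plus_in_iff:
  assumes "s \<in> \<S> (Suc n)" "n \<ge> 1"
  shows "seq_plus s \<in> \<S> n \<longleftrightarrow> s ! n < n"
proof -
  have len: "length s = Suc n" and le: "\<And>i. i < Suc n \<Longrightarrow> s ! i \<le> i"
    using assms(1) by (auto simp: \<S>_def)
  have last: "last s = s ! n"
    using len by (subst last_conv_nth) auto
  have nth: "seq_plus s ! i = (if i = n - 1 then s ! n else s ! i)" if "i < n" for i
    using that len last by (auto simp: seq_plus_def nth_append nth_butlast)
  have "length (seq_plus s) = n"
    using len assms(2) by (simp add: seq_plus_def)
  then have "seq_plus s \<in> \<S> n \<longleftrightarrow> (\<forall>i<n. (if i = n - 1 then s ! n else s ! i) \<le> i)"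
    by (simp add: \<S>_def nth)
  also have "\<dots> \<longleftrightarrow> s ! n \<le> n - 1"
    using assms(2) le by auto
  finally show ?thesis
    using assms(2) by auto
qed

text \<open>The children of a node, from left to right.\<close>

fun children :: "nat list \<times> nat \<Rightarrow> (nat list \<times> nat) list" where
  "children (t, k) =
     (if length t < 2 then []
      else if last t = length t - 1 then [(seq_minus t, 0)]
      else [(seq_plus t, k + 1), (seq_minus t, 0)])"

text \<open>The labels of the nodes \<open>j\<close> levels below a list of nodes, from left to right; distinct nodes of
  the tree may carry the same label.\<close>

fun descend :: "nat \<Rightarrow> (nat list \<times> nat) list \<Rightarrow> (nat list \<times> nat) list" where
  "descend 0 ns = ns"
| "descend (Suc j) ns = descend j (concat (map children ns))"

definition tree_level :: "nat list \<Rightarrow> nat \<Rightarrow> (nat list \<times> nat) list" where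
  "tree_level s j = descend j [(s, 0)]"

definition leaves :: "nat list \<Rightarrow> (nat list \<times> nat) list" where
  "leaves s = tree_level s (length s - 1)"

definition num_leaves :: "nat list \<Rightarrow> nat"  (\<open>\<ell>\<close>) where
  "\<ell> s = length (leaves s)"

definition wt :: "nat list \<Rightarrow> nat \<Rightarrow> nat" where
  "wt s i = snd (leaves s ! i)"


lemma last_in_\<S>:
  assumes "s \<in> \<S> (Suc n)"
  shows "last s = s ! n" "s ! n \<le> n"
proof -
  have "length s = Suc n" "s ! n \<le> n"
    using assms by (simp_all add: \<S>_def)
  moreover from this(1) have "s \<noteq> []" by auto
  ultimately show "last s = s ! n" "s ! n \<le> n"
    by (simp_all add: last_conv_nth)
qed

lemma descend_append: "descend j (xs @ ys) = descend j xs @ descend j ys"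
  by (induction j arbitrary: xs ys) simp_all

lemma fst_children_cong:
  "map fst xs = map fst ys \<Longrightarrow>
   map fst (concat (map children xs)) = map fst (concat (map children ys))"
proof (induction xs arbitrary: ys)
  case (Cons x xs)
  then obtain y ys' where y: "ys = y # ys'" "fst x = fst y" "map fst xs = map fst ys'"
    by (cases ys) auto
  obtain t k l where "x = (t, k)" "y = (t, l)"
    using y(2) by (cases x, cases y) auto
  with Cons.IH[OF y(3)] y(1) show ?case
    by auto
qed simp

lemma fst_descend_cong:
  "map fst xs = map fst ys \<Longrightarrow> map fst (descend j xs) = map fst (descend j ys)"
proof (induction j arbitrary: xs ys)
  case (Suc j)
  show ?case
    unfolding descend.simps by (rule Suc.IH[OF fst_children_cong[OF Suc.prems]])
qed simp

lemma leaves_singleton: "s \<in> \<S> 1 \<Longrightarrow> leaves s = [([0], 0)]"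
  by (auto simp: leaves_def tree_level_def \<S>_def length_Suc_conv)

lemma leaves_eq:
  assumes s: "s \<in> \<S> (Suc n)" and n: "n \<ge> 1" and eq: "s ! n = n"
  shows "leaves s = leaves (seq_minus s)"
proof -
  obtain m where m: "n = Suc m"
    using n by (cases n) auto
  have "length s = Suc n"
    using s by (simp add: \<S>_def)
  then show ?thesis
    using eq last_in_\<S>(1)[OF s] by (simp add: leaves_def seq_minus_def tree_level_def m)
qed

lemma leaves_less:
  assumes s: "s \<in> \<S> (Suc n)" and n: "n \<ge> 1" and less: "s ! n < n"
  shows "leaves s = descend (n - 1) [(seq_plus s, 1)] @ leaves (seq_minus s)"
    and "map fst (descend (n - 1) [(seq_plus s, 1)]) = map fst (leaves (seq_plus s))"
proof -
  obtain m where m: "n = Suc m"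
    using n by (cases n) auto
  have len: "length s = Suc n"
    using s by (simp add: \<S>_def)
  then show "leaves s = descend (n - 1) [(seq_plus s, 1)] @ leaves (seq_minus s)"
    using less last_in_\<S>(1)[OF s] descend_append[of m "[(seq_plus s, 1)]" "[(seq_minus s, 0)]"]
    by (simp add: leaves_def seq_minus_def tree_level_def m)
  have "length (seq_plus s) = n"
    using len n by (simp add: seq_plus_def)
  then show "map fst (descend (n - 1) [(seq_plus s, 1)]) = map fst (leaves (seq_plus s))"
    using fst_descend_cong[of "[(seq_plus s, 1)]" "[(seq_plus s, 0)]" "n - 1"]
    by (simp add: leaves_def tree_level_def)
qed

lemma num_leaves_less:
  assumes "s \<in> \<S> (Suc n)" "n \<ge> 1" "s ! n < n"
  shows "\<ell> s = \<ell> (seq_plus s) + \<ell> (seq_minus s)"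
  using leaves_less(1)[OF assms] arg_cong[OF leaves_less(2)[OF assms], of length]
  by (simp add: num_leaves_def)

lemma leaves_label: "s \<in> \<S> (Suc n) \<Longrightarrow> fst ` set (leaves s) = {[0]}"
proof (induction n arbitrary: s)
  case 0
  then show ?case by (simp add: leaves_singleton)
next
  case (Suc n)
  note minus = seq_minus_in[OF Suc.prems]
  show ?case
  proof (cases "s ! Suc n = Suc n")
    case True
    then show ?thesis
      using leaves_eq[OF Suc.prems] Suc.IH[OF minus] by simp
  next
    case False
    then have less: "s ! Suc n < Suc n"
      using last_in_\<S>(2)[OF Suc.prems] by simp
    then have plus: "seq_plus s \<in> \<S> (Suc n)"
      using seq_plus_in_iff[OF Suc.prems] by simp
    note l = leaves_less[OF Suc.prems _ less, simplified]
    have "fst ` set (descend n [(seq_plus s, 1)]) = fst ` set (leaves (seq_plus s))"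
      using arg_cong[OF l(2), of set] by simp
    then show ?thesis
      using Suc.IH[OF minus] Suc.IH[OF plus] by (simp add: l(1) image_Un)
  qed
qed


section \<open>The chains assigned to sequences\<close>

text \<open>A carrier type closed under the operations used in the recursion: each clause forms the
  ordered sum or product and transports it along an injective constructor.\<close>

datatype 'a point =
    Base 'a
  | Times_Z "'a point \<times> int"
  | Plus_Times_N "'a point + 'a point \<times> nat"

function \<A> :: "nat list \<Rightarrow> (nat \<Rightarrow> 'a rel) \<Rightarrow> 'a point rel" where
  "\<A> s M =
     (if length s < 2 then dir_image (M 0) Base
      else if last s = length s - 1 then
        dir_image (chain_times (\<A> (seq_minus s) M) int_chain) Times_Z
      else
        dir_image
          (chain_plus (\<A> (seq_plus s) M)
             (chain_times (\<A> (seq_minus s) (\<lambda>i. M (\<ell> (seq_plus s) + i))) nat_chain))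
          Plus_Times_N)"
  by pat_completeness auto
termination
  by (relation "measure (\<lambda>(s, M). length s)") (auto simp: seq_minus_def seq_plus_def)

declare \<A>.simps [simp del]

end

theory Submission
  imports Defs
begin

text \<open>
  The chain \<open>A = \<A>(s)\<close> remembers how it was built. If \<open>|s| = m + 2\<close>, then \<open>A\<close> is \<open>\<A>(s\<^sup>-) \<int>\<close> or
  \<open>\<A>(s\<^sup>+) + \<A>(s\<^sup>-) \<nat>\<close>, and the \<open>\<rho>\<^bsub>\<omega>+m\<^esub>\<close>-classes of \<open>A\<close> are exactly the displayed copies of
  \<open>\<A>(s\<^sup>+)\<close> and \<open>\<A>(s\<^sup>-)\<close>. Each copy is condensed to a point by induction on the length. Neighbouring
  copies do not merge: at the bottom, a uniform chain of rank \<open>\<omega>\<close> has no tail of finite rank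
  (\<open>rank_omega_not_wcond_above\<close>), and one step up infinitely many classes lie above every point of a
  copy (\<open>solid_Suc\<close>). Condensation can be computed in any convex subchain and is preserved by
  isomorphisms (\<open>wcond_convex_embedding\<close>). This has two consequences.

  An isomorphism \<open>\<A>(s)[M] \<cong> \<A>(t)[N]\<close> matches classes with classes and a least class with a least
  class, so by induction \<open>M\<^sub>i \<cong> N\<^sub>i\<close> for all \<open>i\<close> (\<open>\<A>_iso_imp_leaves_iso\<close>).

  If the tails of \<open>\<A>(s)[M]\<close> are merely isomorphic to those of \<open>\<A>(t)[N]\<close>, then an isomorphism between
  two tails restricts to one between tails of the classes of their first points and to full
  isomorphisms between the later classes. Hence \<open>\<A>(s\<^sup>-)\<close> is isomorphic to \<open>\<A>(t\<^sup>-)\<close>, and the tails of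
  \<open>\<A>(s\<^sup>+)\<close> and \<open>\<A>(s\<^sup>-)\<close> are isomorphic to those of \<open>\<A>(t\<^sup>+)\<close> and \<open>\<A>(t\<^sup>-)\<close>, where \<open>s\<^sup>+\<close> and \<open>t\<^sup>+\<close> are
  disregarded if they do not occur. Comparing all these pairs inductively shows that all \<open>M\<^sub>i\<close> and
  \<open>N\<^sub>j\<close> have isomorphic tails, and that \<open>M\<^sub>i \<cong> N\<^sub>j\<close> whenever the weights agree and are less than the
  depth of the trees (\<open>same_tails_leaves\<close>). The theorem is the case \<open>s = t\<close>, \<open>M = N\<close>, in which the
  hypothesis on tails is uniformity; only the first leaf can have weight equal to the depth
  (\<open>weight_of_leaf\<close>).
\<close>


section \<open>Chains, isomorphisms and convex embeddings\<close>

lemma chain_refl: "chain A \<Longrightarrow> x \<in> Field A \<Longrightarrow> (x, x) \<in> A"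
  by (auto simp: linear_order_on_def partial_order_on_def preorder_on_def refl_on_def)

lemma chain_trans: "chain A \<Longrightarrow> (x, y) \<in> A \<Longrightarrow> (y, z) \<in> A \<Longrightarrow> (x, z) \<in> A"
  by (auto simp: linear_order_on_def partial_order_on_def preorder_on_def elim: transE)

lemma chain_antisym: "chain A \<Longrightarrow> (x, y) \<in> A \<Longrightarrow> (y, x) \<in> A \<Longrightarrow> x = y"
  by (auto simp: linear_order_on_def partial_order_on_def antisym_def)

lemma chain_linear:
  "chain A \<Longrightarrow> x \<in> Field A \<Longrightarrow> y \<in> Field A \<Longrightarrow> (x, y) \<in> A \<or> (y, x) \<in> A"
  by (cases "x = y") (auto simp: chain_refl linear_order_on_def total_on_def)

lemma chainI:
  assumes "\<And>x. x \<in> Field A \<Longrightarrow> (x, x) \<in> A"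
    and "\<And>x y z. (x, y) \<in> A \<Longrightarrow> (y, z) \<in> A \<Longrightarrow> (x, z) \<in> A"
    and "\<And>x y. (x, y) \<in> A \<Longrightarrow> (y, x) \<in> A \<Longrightarrow> x = y"
    and "\<And>x y. x \<in> Field A \<Longrightarrow> y \<in> Field A \<Longrightarrow> (x, y) \<in> A \<or> (y, x) \<in> A"
  shows "chain A"
proof -
  have "A \<subseteq> Field A \<times> Field A"
    by (auto simp: FieldI1 FieldI2)
  moreover have "refl_on (Field A) A"
    using assms(1) by (rule refl_onI)
  moreover have "trans A" "antisym A"
    using assms(2,3) by (blast intro: transI antisymI)+
  moreover have "total_on (Field A) A"
    using assms(4) by (simp add: total_on_def)
  ultimately show ?thesis
    by (simp add: linear_order_on_def partial_order_on_def preorder_on_def)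
qed

lemma Field_Restr_chain: "chain A \<Longrightarrow> Field (Restr A S) = Field A \<inter> S"
  by (rule Refl_Field_Restr)
    (simp add: linear_order_on_def partial_order_on_def preorder_on_def)

lemma order_iso_refl: "A \<cong>\<^sub>o A"
  unfolding order_iso_iff by (rule exI[of _ id]) auto

lemma order_iso_sym:
  assumes "A \<cong>\<^sub>o B"
  shows "B \<cong>\<^sub>o A"
proof -
  obtain f where f: "bij_betw f (Field A) (Field B)"
    "\<And>x y. x \<in> Field A \<Longrightarrow> y \<in> Field A \<Longrightarrow> (x, y) \<in> A \<longleftrightarrow> (f x, f y) \<in> B"
    using assms unfolding order_iso_iff by blast
  let ?g = "inv_into (Field A) f"
  have g: "bij_betw ?g (Field B) (Field A)"
    by (rule bij_betw_inv_into[OF f(1)])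
  have "(x, y) \<in> B \<longleftrightarrow> (?g x, ?g y) \<in> A" if "x \<in> Field B" "y \<in> Field B" for x y
    using f(2)[of "?g x" "?g y"] bij_betw_inv_into_right[OF f(1)] that
      bij_betw_apply[OF g that(1)] bij_betw_apply[OF g that(2)] by simp
  with g show ?thesis
    unfolding order_iso_iff by blast
qed

lemma order_iso_trans:
  assumes "A \<cong>\<^sub>o B" "B \<cong>\<^sub>o C"
  shows "A \<cong>\<^sub>o C"
proof -
  obtain f where f: "bij_betw f (Field A) (Field B)"
    "\<And>x y. x \<in> Field A \<Longrightarrow> y \<in> Field A \<Longrightarrow> (x, y) \<in> A \<longleftrightarrow> (f x, f y) \<in> B"
    using assms(1) unfolding order_iso_iff by blast
  obtain g where g: "bij_betw g (Field B) (Field C)"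
    "\<And>x y. x \<in> Field B \<Longrightarrow> y \<in> Field B \<Longrightarrow> (x, y) \<in> B \<longleftrightarrow> (g x, g y) \<in> C"
    using assms(2) unfolding order_iso_iff by blast
  have "\<forall>x\<in>Field A. \<forall>y\<in>Field A. (x, y) \<in> A \<longleftrightarrow> ((g \<circ> f) x, (g \<circ> f) y) \<in> C"
    using f g bij_betwE[OF f(1)] by simp
  with bij_betw_trans[OF f(1) g(1)] show ?thesis
    unfolding order_iso_iff by blast
qed

lemma Restr_order_isoI:
  assumes "chain A" "chain B" "S \<subseteq> Field A" "T \<subseteq> Field B" "bij_betw f S T"
    and "\<And>x y. x \<in> S \<Longrightarrow> y \<in> S \<Longrightarrow> (x, y) \<in> A \<longleftrightarrow> (f x, f y) \<in> B"
  shows "Restr A S \<cong>\<^sub>o Restr B T"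
proof -
  have "Field (Restr A S) = S" "Field (Restr B T) = T"
    using assms(1-4) by (auto simp: Field_Restr_chain)
  then show ?thesis
    unfolding order_iso_iff using assms(5,6) bij_betwE[OF assms(5)]
    by (intro exI[of _ f]) auto
qed

lemma Field_tail: "chain A \<Longrightarrow> Field (tail A x) = above A x"
  by (auto simp: tail_def Field_Restr_chain above_def FieldI2)

lemma chain_tail: "chain A \<Longrightarrow> chain (tail A x)"
  unfolding tail_def by (rule Linear_order_Restr)

lemma tail_order_iso:
  assumes "chain A" "chain B" and f: "bij_betw f (Field A) (Field B)"
    "\<And>x y. x \<in> Field A \<Longrightarrow> y \<in> Field A \<Longrightarrow> (x, y) \<in> A \<longleftrightarrow> (f x, f y) \<in> B"
    and x: "x \<in> Field A"
  shows "tail A x \<cong>\<^sub>o tail B (f x)"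
proof -
  have sub: "above A x \<subseteq> Field A" "above B (f x) \<subseteq> Field B"
    by (auto simp: above_def intro: FieldI2)
  have mem: "f y \<in> above B (f x) \<longleftrightarrow> y \<in> above A x" if "y \<in> Field A" for y
    using f(2)[OF x that] by (simp add: above_def)
  have "f ` above A x = above B (f x)"
  proof
    show "f ` above A x \<subseteq> above B (f x)"
      using mem sub(1) by blast
    show "above B (f x) \<subseteq> f ` above A x"
    proof
      fix y assume y: "y \<in> above B (f x)"
      then obtain z where "z \<in> Field A" "y = f z"
        using f(1) sub(2) unfolding bij_betw_def by blast
      with y mem show "y \<in> f ` above A x"
        by blast
    qed
  qed
  moreover have "inj_on f (above A x)"
    using f(1) sub(1) unfolding bij_betw_def by (blast intro: inj_on_subset)
  ultimately have "bij_betw f (above A x) (above B (f x))"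
    by (simp add: bij_betw_def)
  then show ?thesis
    unfolding tail_def
    using Restr_order_isoI[OF assms(1,2) sub] f(2) sub(1) by blast
qed

text \<open>An order embedding of \<open>A\<close> into \<open>B\<close> whose image is convex. Isomorphisms and
  inclusions of convex subchains are the two cases that matter.\<close>

definition convex_embedding :: "'a rel \<Rightarrow> 'b rel \<Rightarrow> ('a \<Rightarrow> 'b) \<Rightarrow> bool" where
  "convex_embedding A B f \<longleftrightarrow>
     (\<forall>x\<in>Field A. f x \<in> Field B) \<and>
     (\<forall>x\<in>Field A. \<forall>y\<in>Field A. (x, y) \<in> A \<longleftrightarrow> (f x, f y) \<in> B) \<and>
     (\<forall>x\<in>Field A. \<forall>y\<in>Field A. \<forall>z. (f x, z) \<in> B \<longrightarrow> (z, f y) \<in> B \<longrightarrow> z \<in> f ` Field A)"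

lemma convex_embedding_inj:
  assumes "chain A" "chain B" "convex_embedding A B f" "x \<in> Field A" "y \<in> Field A" "f x = f y"
  shows "x = y"
  using assms unfolding convex_embedding_def by (metis chain_antisym chain_refl)

lemma convex_embedding_comp:
  assumes "convex_embedding A B f" "convex_embedding B C g"
  shows "convex_embedding A C (g \<circ> f)"
  unfolding convex_embedding_def
proof (intro conjI ballI allI impI)
  fix x y z assume x: "x \<in> Field A" and y: "y \<in> Field A"
    and xz: "((g \<circ> f) x, z) \<in> C" and zy: "(z, (g \<circ> f) y) \<in> C"
  have f: "f x \<in> Field B" "f y \<in> Field B"
    using assms(1) x y by (auto simp: convex_embedding_def)
  then have "z \<in> g ` Field B"
    using assms(2) xz zy unfolding convex_embedding_def by auto
  then obtain w where w: "w \<in> Field B" "z = g w"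
    by blast
  then have "(f x, w) \<in> B" "(w, f y) \<in> B"
    using assms(2) xz zy f by (auto simp: convex_embedding_def)
  then show "z \<in> (g \<circ> f) ` Field A"
    using assms(1) x y w unfolding convex_embedding_def by fastforce
qed (use assms in \<open>auto simp: convex_embedding_def\<close>)

lemma convex_embedding_id: "convex_embedding A A id"
  by (simp add: convex_embedding_def) (blast intro: FieldI2)

lemma convex_embedding_of_iso:
  assumes "bij_betw f (Field A) (Field B)"
    "\<And>x y. x \<in> Field A \<Longrightarrow> y \<in> Field A \<Longrightarrow> (x, y) \<in> A \<longleftrightarrow> (f x, f y) \<in> B"
  shows "convex_embedding A B f"
  using assms unfolding convex_embedding_def bij_betw_def by (blast intro: FieldI2)

lemma convex_embedding_Restr:
  assumes "chain A" "S \<subseteq> Field A"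
    and "\<And>x y z. x \<in> S \<Longrightarrow> y \<in> S \<Longrightarrow> (x, z) \<in> A \<Longrightarrow> (z, y) \<in> A \<Longrightarrow> z \<in> S"
  shows "convex_embedding (Restr A S) A id"
proof -
  have F: "Field (Restr A S) = S"
    using assms(1,2) by (auto simp: Field_Restr_chain)
  show ?thesis
    unfolding convex_embedding_def F id_apply image_id using assms(2,3) by blast
qed

lemma convex_embedding_tail: "chain A \<Longrightarrow> convex_embedding (tail A x) A id"
  unfolding tail_def
  by (rule convex_embedding_Restr) (auto simp only: above_def mem_Collect_eq intro: FieldI2 elim: chain_trans)

lemma interval_between_image:
  assumes "convex_embedding A B f" "x \<in> Field A" "y \<in> Field A"
  shows "interval_between B (f x) (f y) = f ` interval_between A x y"
proof
  show "interval_between B (f x) (f y) \<subseteq> f ` interval_between A x y"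
  proof
    fix z assume z: "z \<in> interval_between B (f x) (f y)"
    then have "z \<in> f ` Field A"
      using assms by (auto simp: interval_between_def convex_embedding_def)
    then obtain w where "w \<in> Field A" "z = f w"
      by blast
    with z show "z \<in> f ` interval_between A x y"
      using assms by (auto simp: interval_between_def convex_embedding_def)
  qed
  show "f ` interval_between A x y \<subseteq> interval_between B (f x) (f y)"
    using assms by (auto simp: interval_between_def convex_embedding_def)
qed


section \<open>Iterated condensation\<close>

text \<open>Equivalence relations on the carrier of a chain with convex classes. By symmetry and
  transitivity it is enough that a class containing \<open>x \<le> z\<close> relates \<open>x\<close> to every point between.\<close>

definition convex_equiv :: "'a rel \<Rightarrow> 'a rel \<Rightarrow> bool" where
  "convex_equiv A E \<longleftrightarrow>
     E \<subseteq> Field A \<times> Field A \<and> (\<forall>x\<in>Field A. (x, x) \<in> E) \<and>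
     (\<forall>x y. (x, y) \<in> E \<longrightarrow> (y, x) \<in> E) \<and>
     (\<forall>x y z. (x, y) \<in> E \<longrightarrow> (y, z) \<in> E \<longrightarrow> (x, z) \<in> E) \<and>
     (\<forall>x y z. (x, y) \<in> A \<longrightarrow> (y, z) \<in> A \<longrightarrow> (x, z) \<in> E \<longrightarrow> (x, y) \<in> E)"

text \<open>For a convex equivalence relation the order on the quotient need not be mentioned: two
  points are condensed if only finitely many classes meet the interval between them.\<close>

definition cond :: "'a rel \<Rightarrow> 'a rel \<Rightarrow> 'a rel" where
  "cond A E = {(x, y). x \<in> Field A \<and> y \<in> Field A \<and>
     finite ((\<lambda>z. E `` {z}) ` interval_between A x y)}"

lemma convex_equivD:
  assumes "convex_equiv A E"
  shows "(x, y) \<in> E \<Longrightarrow> x \<in> Field A" "(x, y) \<in> E \<Longrightarrow> y \<in> Field A"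
    "x \<in> Field A \<Longrightarrow> (x, x) \<in> E" "(x, y) \<in> E \<Longrightarrow> (y, x) \<in> E"
    "(x, y) \<in> E \<Longrightarrow> (y, z) \<in> E \<Longrightarrow> (x, z) \<in> E"
    "(x, y) \<in> A \<Longrightarrow> (y, z) \<in> A \<Longrightarrow> (x, z) \<in> E \<Longrightarrow> (x, y) \<in> E"
  using assms unfolding convex_equiv_def by blast+

lemma convex_equiv_right:
  assumes "convex_equiv A E" "(x, y) \<in> A" "(y, z) \<in> A" "(x, z) \<in> E"
  shows "(y, z) \<in> E"
  using assms convex_equivD by metis

lemma convex_equiv_class_eq_iff:
  assumes "convex_equiv A E" "x \<in> Field A" "y \<in> Field A"
  shows "E `` {x} = E `` {y} \<longleftrightarrow> (x, y) \<in> E"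
proof
  assume "E `` {x} = E `` {y}"
  moreover have "y \<in> E `` {y}" using assms convex_equivD(3) by fast
  ultimately show "(x, y) \<in> E" by blast
next
  assume "(x, y) \<in> E"
  then show "E `` {x} = E `` {y}"
    using convex_equivD(4,5)[OF assms(1)] by blast
qed

lemma condense_eq_cond:
  assumes A: "chain A" and E: "convex_equiv A E"
  shows "condense A E = cond A E"
proof -
  let ?c = "\<lambda>z. E `` {z}" and ?Q = "quotient_chain A E"
  \<comment> \<open>comparable classes have comparable members unless they coincide\<close>
  have le: "(x, z) \<in> A"
    if Q: "(?c x, ?c z) \<in> ?Q" and ne: "(x, z) \<notin> E" and f: "x \<in> Field A" "z \<in> Field A" for x z
  proof (rule ccontr)
    assume "(x, z) \<notin> A"
    then have zx: "(z, x) \<in> A" using chain_linear[OF A f] by blast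
    obtain x' z' where x': "(x, x') \<in> E" and z': "(z, z') \<in> E" and le: "(x', z') \<in> A"
      using Q by (auto simp: quotient_chain_def)
    have "(z', x) \<in> A \<or> (x, z') \<in> A"
      using chain_linear[OF A _ f(1)] convex_equivD(2)[OF E z'] by blast
    then show False
    proof
      assume "(z', x) \<in> A"
      then have "(x', z') \<in> E"
        using convex_equivD(6)[OF E le _ convex_equivD(4)[OF E x']] by simp
      from convex_equivD(5)[OF E convex_equivD(5)[OF E x' this] convex_equivD(4)[OF E z']] ne
      show False by blast
    next
      assume "(x, z') \<in> A"
      then have "(z, x) \<in> E"
        using convex_equivD(6)[OF E zx _ z'] by simp
      from convex_equivD(4)[OF E this] ne show False by blast
    qed
  qed
  have Qle: "(?c x, ?c z) \<in> ?Q" if "(x, z) \<in> A" for x z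
  proof -
    have f: "x \<in> Field A" "z \<in> Field A"
      using that by (auto intro: FieldI1 FieldI2)
    then have "x \<in> ?c x" "z \<in> ?c z"
      using convex_equivD(3)[OF E] by auto
    with f that show ?thesis
      unfolding quotient_chain_def quotient_def by blast
  qed
  have "interval_between ?Q (?c x) (?c y) = ?c ` interval_between A x y"
    if x: "x \<in> Field A" and y: "y \<in> Field A" for x y
  proof
    show "?c ` interval_between A x y \<subseteq> interval_between ?Q (?c x) (?c y)"
      using Qle by (fastforce simp: interval_between_def intro: FieldI1 FieldI2)
    show "interval_between ?Q (?c x) (?c y) \<subseteq> ?c ` interval_between A x y"
    proof
      fix Z assume Z: "Z \<in> interval_between ?Q (?c x) (?c y)"
      then have "Z \<in> Field A // E"
        by (auto simp: interval_between_def quotient_chain_def)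
      then obtain z where z: "z \<in> Field A" "Z = ?c z"
        by (auto simp: quotient_def)
      have xy: "x \<in> interval_between A x y" "y \<in> interval_between A x y"
        using x y A by (auto simp: interval_between_def chain_refl dest: chain_linear)
      show "Z \<in> ?c ` interval_between A x y"
      proof (cases "(x, z) \<in> E \<or> (z, y) \<in> E")
        case True
        then have "Z = ?c x \<or> Z = ?c y"
          using x y z convex_equiv_class_eq_iff[OF E] by metis
        then show ?thesis using xy by blast
      next
        case False
        then have ne: "(x, z) \<notin> E" "(z, x) \<notin> E" "(z, y) \<notin> E" "(y, z) \<notin> E"
          using convex_equivD(4)[OF E] by blast+
        have "z \<in> interval_between A x y"
          using Z le[OF _ ne(1) x z(1)] le[OF _ ne(2) z(1) x] le[OF _ ne(3) z(1) y]
            le[OF _ ne(4) y z(1)] z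
          unfolding interval_between_def by blast
        then show ?thesis using z by blast
      qed
    qed
  qed
  then show ?thesis
    by (auto simp: condense_def cond_def)
qed

lemma subset_cond:
  assumes A: "chain A" and E: "convex_equiv A E"
  shows "E \<subseteq> cond A E"
proof
  fix p assume "p \<in> E"
  then obtain x y where p: "p = (x, y)" "(x, y) \<in> E"
    by (cases p) auto
  have "E `` {z} = E `` {x}" if "z \<in> interval_between A x y" for z
  proof -
    have z: "z \<in> Field A"
      using that by (simp add: interval_between_def)
    have "(x, z) \<in> E"
      using that convex_equivD(6)[OF E _ _ p(2)] convex_equivD(4)[OF E p(2)]
        convex_equiv_right[OF E, of y z x] convex_equivD(4)[OF E]
      unfolding interval_between_def by blast
    then show ?thesis
      using convex_equiv_class_eq_iff[OF E convex_equivD(1)[OF E p(2)] z] by simp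
  qed
  then have "(\<lambda>z. E `` {z}) ` interval_between A x y \<subseteq> {E `` {x}}"
    by blast
  then have "finite ((\<lambda>z. E `` {z}) ` interval_between A x y)"
    by (rule finite_subset) simp
  then show "p \<in> cond A E"
    using p convex_equivD(1,2)[OF E p(2)] by (simp add: cond_def)
qed

lemma convex_equiv_cond:
  assumes A: "chain A" and E: "convex_equiv A E"
  shows "convex_equiv A (cond A E)"
proof -
  have tr: "(x, z) \<in> cond A E" if "(x, y) \<in> cond A E" "(y, z) \<in> cond A E" for x y z
  proof -
    have f: "x \<in> Field A" "y \<in> Field A" "z \<in> Field A"
      using that by (auto simp: cond_def)
    have "interval_between A x z \<subseteq> interval_between A x y \<union> interval_between A y z"
    proof
      fix w assume "w \<in> interval_between A x z"
      then show "w \<in> interval_between A x y \<union> interval_between A y z"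
        using chain_linear[OF A, of w y] f unfolding interval_between_def by blast
    qed
    then have "(\<lambda>z. E `` {z}) ` interval_between A x z \<subseteq>
       (\<lambda>z. E `` {z}) ` interval_between A x y \<union> (\<lambda>z. E `` {z}) ` interval_between A y z"
      by blast
    then have "finite ((\<lambda>z. E `` {z}) ` interval_between A x z)"
      by (rule finite_subset) (use that in \<open>simp add: cond_def\<close>)
    then show ?thesis
      using f by (simp add: cond_def)
  qed
  have cv: "(x, y) \<in> cond A E" if "(x, y) \<in> A" "(y, z) \<in> A" "(x, z) \<in> cond A E" for x y z
  proof -
    have "interval_between A x y \<subseteq> interval_between A x z"
      using that(1,2) chain_trans[OF A] chain_antisym[OF A] unfolding interval_between_def by blast
    then have "(\<lambda>z. E `` {z}) ` interval_between A x y \<subseteq> (\<lambda>z. E `` {z}) ` interval_between A x z"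
      by blast
    then have "finite ((\<lambda>z. E `` {z}) ` interval_between A x y)"
      by (rule finite_subset) (use that in \<open>simp add: cond_def\<close>)
    then show ?thesis
      using that FieldI2[OF that(1)] by (simp add: cond_def)
  qed
  have sy: "(y, x) \<in> cond A E" if "(x, y) \<in> cond A E" for x y
  proof -
    have "interval_between A x y = interval_between A y x"
      unfolding interval_between_def by blast
    then show ?thesis using that by (simp add: cond_def)
  qed
  have "cond A E \<subseteq> Field A \<times> Field A"
    by (auto simp: cond_def)
  moreover have "\<forall>x\<in>Field A. (x, x) \<in> cond A E"
    using subset_cond[OF A E] convex_equivD(3)[OF E] by blast
  ultimately show ?thesis
    unfolding convex_equiv_def using tr cv sy by blast
qed

lemma finite_image_factor:
  assumes "finite (g ` S)" "\<And>z w. z \<in> S \<Longrightarrow> w \<in> S \<Longrightarrow> g z = g w \<Longrightarrow> h z = h w"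
  shows "finite (h ` S)"
proof -
  have "h ` S \<subseteq> (\<lambda>c. h (SOME z. z \<in> S \<and> g z = c)) ` g ` S"
  proof
    fix v assume "v \<in> h ` S"
    then obtain z where z: "z \<in> S" "v = h z" by blast
    let ?w = "SOME w. w \<in> S \<and> g w = g z"
    have "?w \<in> S \<and> g ?w = g z"
      by (rule someI[of _ z]) (use z in simp)
    then have "h ?w = v"
      using assms(2) z by metis
    then show "v \<in> (\<lambda>c. h (SOME z. z \<in> S \<and> g z = c)) ` g ` S"
      using z(1) by blast
  qed
  then show ?thesis
    by (rule finite_subset) (use assms(1) in simp)
qed

lemma cond_convex_embedding:
  assumes E: "convex_equiv A E" and F: "convex_equiv B F" and f: "convex_embedding A B f"
    and eq: "\<And>x y. x \<in> Field A \<Longrightarrow> y \<in> Field A \<Longrightarrow> (x, y) \<in> E \<longleftrightarrow> (f x, f y) \<in> F"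
    and x: "x \<in> Field A" and y: "y \<in> Field A"
  shows "(x, y) \<in> cond A E \<longleftrightarrow> (f x, f y) \<in> cond B F"
proof -
  let ?S = "interval_between A x y"
  have fB: "f z \<in> Field B" if "z \<in> Field A" for z
    using f that by (auto simp: convex_embedding_def)
  have S: "z \<in> Field A" if "z \<in> ?S" for z
    using that by (simp add: interval_between_def)
  have same: "E `` {z} = E `` {w} \<longleftrightarrow> F `` {f z} = F `` {f w}" if "z \<in> ?S" "w \<in> ?S" for z w
    using that S fB eq convex_equiv_class_eq_iff[OF E] convex_equiv_class_eq_iff[OF F] by simp
  have "finite ((\<lambda>z. E `` {z}) ` ?S) \<longleftrightarrow> finite ((\<lambda>z. F `` {f z}) ` ?S)"
    using finite_image_factor[of "\<lambda>z. E `` {z}" ?S "\<lambda>z. F `` {f z}"]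
      finite_image_factor[of "\<lambda>z. F `` {f z}" ?S "\<lambda>z. E `` {z}"] same
    by blast
  moreover have "(\<lambda>z. F `` {f z}) ` ?S = (\<lambda>z. F `` {z}) ` interval_between B (f x) (f y)"
    using interval_between_image[OF f x y] by (simp add: image_image)
  ultimately show ?thesis
    using x y fB by (simp add: cond_def)
qed

text \<open>\<open>fcond n\<close> and \<open>wcond m\<close> are the relations \<open>\<rho>\<^sub>\<alpha>\<close> for \<open>\<alpha> = n\<close> and \<open>\<alpha> = \<omega> + m\<close>. Natural numbers
  suffice as indices because the chains \<open>\<A>(s)\<close> have ranks below \<open>\<omega> + \<omega>\<close>.\<close>

primrec fcond :: "nat \<Rightarrow> 'a rel \<Rightarrow> 'a rel" where
  "fcond 0 A = Id_on (Field A)"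
| "fcond (Suc n) A = cond A (fcond n A)"

primrec wcond :: "nat \<Rightarrow> 'a rel \<Rightarrow> 'a rel" where
  "wcond 0 A = (\<Union>n. fcond n A)"
| "wcond (Suc m) A = cond A (wcond m A)"

lemma convex_equiv_fcond: "chain A \<Longrightarrow> convex_equiv A (fcond n A)"
proof (induction n)
  case 0
  then show ?case
    by (auto simp: convex_equiv_def dest: chain_antisym)
qed (simp add: convex_equiv_cond)

lemma \<rho>_eq_fcond: "chain A \<Longrightarrow> \<rho> A (enat n) = fcond n A"
  by (induction n)
    (simp_all add: \<rho>_enat_0 \<rho>_enat_Suc condense_eq_cond convex_equiv_fcond flip: zero_enat_def)

lemma \<rho>_eq_wcond: "chain A \<Longrightarrow> \<rho> A (\<infinity> :: enat) = wcond 0 A"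
  by (simp add: \<rho>_enat_infinity \<rho>_eq_fcond)

lemma fcond_mono: "chain A \<Longrightarrow> m \<le> n \<Longrightarrow> fcond m A \<subseteq> fcond n A"
proof (induction n rule: nat_induct)
  case (Suc n)
  then show ?case
    using subset_cond[OF Suc.prems(1) convex_equiv_fcond[OF Suc.prems(1), of n]]
    by (cases "m = Suc n") auto
qed simp

lemma convex_equiv_wcond: "chain A \<Longrightarrow> convex_equiv A (wcond m A)"
proof (induction m)
  case 0
  note E = convex_equivD[OF convex_equiv_fcond[OF 0]]
  have tr: "(x, z) \<in> wcond 0 A" if xy: "(x, y) \<in> wcond 0 A" and yz: "(y, z) \<in> wcond 0 A" for x y z
  proof -
    obtain i j where "(x, y) \<in> fcond i A" "(y, z) \<in> fcond j A"
      using xy yz by auto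
    then have "(x, y) \<in> fcond (max i j) A" "(y, z) \<in> fcond (max i j) A"
      using fcond_mono[OF 0] by (meson max.cobounded1 max.cobounded2 subsetD)+
    from E(5)[OF this] show ?thesis by auto
  qed
  have w: "(x, y) \<in> wcond 0 A \<longleftrightarrow> (\<exists>n. (x, y) \<in> fcond n A)" for x y
    by simp
  have "wcond 0 A \<subseteq> Field A \<times> Field A"
    using E(1,2) w by (auto simp del: wcond.simps)
  moreover have "\<forall>x\<in>Field A. (x, x) \<in> wcond 0 A"
    using E(3) w by blast
  moreover have "\<forall>x y. (x, y) \<in> wcond 0 A \<longrightarrow> (y, x) \<in> wcond 0 A"
    using E(4) w by blast
  moreover have
    "\<forall>x y z. (x, y) \<in> A \<longrightarrow> (y, z) \<in> A \<longrightarrow> (x, z) \<in> wcond 0 A \<longrightarrow> (x, y) \<in> wcond 0 A"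
    using E(6) w by blast
  ultimately show ?case
    using tr unfolding convex_equiv_def by blast
qed (simp add: convex_equiv_cond)

text \<open>Condensations are local: they can be computed in any convex subchain.\<close>

lemma fcond_convex_embedding:
  assumes "chain A" "chain B" "convex_embedding A B f" "x \<in> Field A" "y \<in> Field A"
  shows "(x, y) \<in> fcond n A \<longleftrightarrow> (f x, f y) \<in> fcond n B"
  using assms(4,5)
proof (induction n arbitrary: x y)
  case 0
  then show ?case
    using convex_embedding_inj[OF assms(1-3)] assms(3) by (auto simp: convex_embedding_def)
next
  case (Suc n)
  show ?case
    unfolding fcond.simps
    by (rule cond_convex_embedding)
      (use Suc assms(1-3) in \<open>auto intro: convex_equiv_fcond\<close>)
qed

lemma wcond_convex_embedding:
  assumes "chain A" "chain B" "convex_embedding A B f" "x \<in> Field A" "y \<in> Field A"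
  shows "(x, y) \<in> wcond m A \<longleftrightarrow> (f x, f y) \<in> wcond m B"
  using assms(4,5)
proof (induction m arbitrary: x y)
  case 0
  then show ?case
    using fcond_convex_embedding[OF assms(1-3)] by auto
next
  case (Suc m)
  show ?case
    unfolding wcond.simps
    by (rule cond_convex_embedding)
      (use Suc assms(1-3) in \<open>auto intro: convex_equiv_wcond\<close>)
qed


section \<open>Uniform chains of rank \<open>\<omega>\<close>\<close>

lemma quotient_chain_iso_one_iff:
  assumes A: "chain A" and E: "convex_equiv A E"
  shows "quotient_chain A E \<cong>\<^sub>o one_chain \<longleftrightarrow> Field A \<noteq> {} \<and> E = Field A \<times> Field A"
proof -
  have sub: "E \<subseteq> Field A \<times> Field A"
    using E by (simp add: convex_equiv_def)
  have "X \<in> Field (quotient_chain A E)" if X: "X \<in> Field A // E" for X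
  proof -
    obtain x where x: "x \<in> Field A" "X = E `` {x}"
      using X by (auto simp: quotient_def)
    then have "x \<in> X"
      using convex_equivD(3)[OF E] by simp
    then have "(X, X) \<in> quotient_chain A E"
      using X chain_refl[OF A x(1)] unfolding quotient_chain_def by blast
    then show ?thesis by (rule FieldI1)
  qed
  then have Q: "Field (quotient_chain A E) = Field A // E"
    unfolding quotient_chain_def Field_def by blast
  have one: "Field one_chain = {()}"
    by (simp add: one_chain_def)
  show ?thesis
  proof
    assume "quotient_chain A E \<cong>\<^sub>o one_chain"
    then obtain f where f: "bij_betw f (Field A // E) {()}"
      unfolding order_iso_iff Q one by blast
    then have ne: "Field A \<noteq> {}"
      by (auto simp: bij_betw_def quotient_def)
    have "(x, y) \<in> E" if xy: "x \<in> Field A" "y \<in> Field A" for x y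
    proof -
      have "E `` {x} \<in> Field A // E" "E `` {y} \<in> Field A // E"
        using xy by (auto intro: quotientI)
      then have "E `` {x} = E `` {y}"
        using inj_onD[OF bij_betw_imp_inj_on[OF f], of "E `` {x}" "E `` {y}"] by simp
      then show ?thesis
        using convex_equiv_class_eq_iff[OF E xy] by simp
    qed
    with ne sub show "Field A \<noteq> {} \<and> E = Field A \<times> Field A"
      by blast
  next
    assume full: "Field A \<noteq> {} \<and> E = Field A \<times> Field A"
    then have "Field A // E = {Field A}"
      by (auto simp: quotient_def)
    moreover from this full have "(Field A, Field A) \<in> quotient_chain A E"
      using chain_refl[OF A] unfolding quotient_chain_def by blast
    ultimately show "quotient_chain A E \<cong>\<^sub>o one_chain"
      unfolding order_iso_iff Q one
      by (intro exI[of _ "\<lambda>_. ()"]) (simp add: bij_betw_def one_chain_def)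
  qed
qed

lemma rank_omegaD:
  assumes "chain A" "has_rank_omega A"
  shows "Field A \<noteq> {}" "wcond 0 A = Field A \<times> Field A" "fcond n A \<noteq> Field A \<times> Field A"
proof -
  have "quot_level A (\<infinity> :: enat) \<cong>\<^sub>o one_chain" "\<not> quot_level A (enat n) \<cong>\<^sub>o one_chain"
    using assms(2) by (auto simp: has_rank_omega_def has_rank_def)
  then show "Field A \<noteq> {}" "wcond 0 A = Field A \<times> Field A" "fcond n A \<noteq> Field A \<times> Field A"
    unfolding quot_level_def \<rho>_eq_fcond[OF assms(1)] \<rho>_eq_wcond[OF assms(1)]
    using quotient_chain_iso_one_iff[OF assms(1) convex_equiv_wcond[OF assms(1)], of 0]
      quotient_chain_iso_one_iff[OF assms(1) convex_equiv_fcond[OF assms(1)], of n]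
    by blast+
qed

lemma tail_iso_min:
  assumes A: "chain A" and B: "chain B" and x: "x \<in> Field A" and y: "y \<in> Field B"
    and f: "bij_betw f (Field (tail A x)) (Field (tail B y))"
    "\<And>u v. u \<in> Field (tail A x) \<Longrightarrow> v \<in> Field (tail A x) \<Longrightarrow>
      (u, v) \<in> tail A x \<longleftrightarrow> (f u, f v) \<in> tail B y"
  shows "f x = y"
proof -
  have xin: "x \<in> Field (tail A x)" and yin: "y \<in> Field (tail B y)"
    using A B x y by (simp_all add: Field_tail above_def chain_refl)
  then have fx: "f x \<in> above B y"
    using f(1) B by (auto simp: bij_betw_def Field_tail)
  obtain w where w: "w \<in> Field (tail A x)" "y = f w"
    using f(1) yin unfolding bij_betw_def by blast
  have "(x, w) \<in> tail A x"
    using w(1) A x by (simp add: Field_tail) (simp add: tail_def above_def chain_refl)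
  then have "(f x, y) \<in> B"
    using f(2)[OF xin w(1)] w(2) by (simp add: tail_def)
  then show ?thesis
    using fx chain_antisym[OF B] by (simp add: above_def)
qed

text \<open>No point above a uniform chain of rank \<open>\<omega>\<close> is \<open>\<rho>\<^sub>\<omega>\<close>-equivalent to a point of it. Otherwise
  the two are \<open>\<rho>\<^sub>n\<close>-equivalent for some finite \<open>n\<close>, so one tail of the chain, hence by uniformity
  each, lies in a single \<open>\<rho>\<^sub>n\<close>-class, and the chain has finite rank.\<close>

lemma rank_omega_not_wcond_above:
  assumes M: "chain M" "uniform M" "has_rank_omega M"
    and X: "chain X" and g: "convex_embedding M X g"
    and x: "x \<in> Field M" and xy: "(g x, y) \<in> X" and y: "y \<notin> g ` Field M"
  shows "(g x, y) \<notin> wcond 0 X"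
proof
  assume "(g x, y) \<in> wcond 0 X"
  then obtain n where n: "(g x, y) \<in> fcond n X"
    by auto
  have above: "(x, z) \<in> fcond n M" if xz: "(x, z) \<in> M" for z
  proof -
    have z: "z \<in> Field M"
      using xz by (rule FieldI2)
    then have gz: "g z \<in> Field X" and gxz: "(g x, g z) \<in> X"
      using g x xz by (auto simp: convex_embedding_def)
    have "(y, g z) \<notin> X"
      using g x z xy y unfolding convex_embedding_def by blast
    then have "(g z, y) \<in> X"
      using chain_linear[OF X gz FieldI2[OF xy]] by blast
    then have "(g x, g z) \<in> fcond n X"
      using convex_equivD(6)[OF convex_equiv_fcond[OF X] gxz _ n] by blast
    then show ?thesis
      using fcond_convex_embedding[OF M(1) X g x z] by blast
  qed
  have all: "(u, v) \<in> fcond n M" if uv: "(u, v) \<in> M" for u v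
  proof -
    have u: "u \<in> Field M" and v: "v \<in> Field M"
      using uv by (auto intro: FieldI1 FieldI2)
    have "tail M u \<cong>\<^sub>o tail M x"
      using M(2) u x by (simp add: uniform_def)
    then obtain h where h: "bij_betw h (Field (tail M u)) (Field (tail M x))"
      "\<And>p q. p \<in> Field (tail M u) \<Longrightarrow> q \<in> Field (tail M u) \<Longrightarrow>
        (p, q) \<in> tail M u \<longleftrightarrow> (h p, h q) \<in> tail M x"
      unfolding order_iso_iff by blast
    have hu: "h u = x"
      by (rule tail_iso_min[OF M(1) M(1) u x h])
    have in_tail: "u \<in> Field (tail M u)" "v \<in> Field (tail M u)"
      using uv u M(1) by (simp_all add: Field_tail above_def chain_refl)
    have htail: "h u \<in> Field (tail M x)" "h v \<in> Field (tail M x)"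
      using in_tail h(1) by (auto simp: bij_betw_def)
    then have "(x, h v) \<in> M"
      using M(1) by (simp add: Field_tail above_def)
    then have "(h u, h v) \<in> fcond n (tail M x)"
      using above hu fcond_convex_embedding[OF chain_tail[OF M(1)] M(1)
          convex_embedding_tail[OF M(1)] htail] by simp
    then have "(u, v) \<in> fcond n (tail M u)"
      using fcond_convex_embedding[OF chain_tail[OF M(1)] chain_tail[OF M(1)]
          convex_embedding_of_iso[OF h] in_tail] by blast
    then show ?thesis
      using fcond_convex_embedding[OF chain_tail[OF M(1)] M(1)
          convex_embedding_tail[OF M(1)] in_tail] by simp
  qed
  have "(u, v) \<in> fcond n M" if "u \<in> Field M" "v \<in> Field M" for u v
    using chain_linear[OF M(1) that] all convex_equivD(4)[OF convex_equiv_fcond[OF M(1)]] by blast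
  moreover have "fcond n M \<subseteq> Field M \<times> Field M"
    using convex_equiv_fcond[OF M(1)] by (simp add: convex_equiv_def)
  ultimately show False
    using rank_omegaD(3)[OF M(1,3), of n] by auto
qed


section \<open>Condensing chains cut into blocks\<close>

text \<open>A nonempty chain is \<open>m\<close>-solid if, wherever it occurs as a convex subchain, it lies in one
  \<open>wcond m\<close>-class, and that class contains no point above it. The surrounding chains are taken over
  the same type, which is enough because all chains \<open>\<A>(s)\<close> share one type of points.\<close>

definition solid :: "nat \<Rightarrow> 'a rel \<Rightarrow> bool" where
  "solid m C \<longleftrightarrow> chain C \<and> Field C \<noteq> {} \<and>
     (\<forall>(X :: 'a rel) g. chain X \<longrightarrow> convex_embedding C X g \<longrightarrow>
        (\<forall>x\<in>Field C. \<forall>y\<in>Field C. (g x, g y) \<in> wcond m X) \<and>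
        (\<forall>x\<in>Field C. \<forall>y. (g x, y) \<in> X \<longrightarrow> y \<notin> g ` Field C \<longrightarrow> (g x, y) \<notin> wcond m X))"

lemma solidI:
  fixes C :: "'a rel"
  assumes "chain C" "Field C \<noteq> {}"
    and "\<And>(X :: 'a rel) g x y. chain X \<Longrightarrow> convex_embedding C X g \<Longrightarrow> x \<in> Field C \<Longrightarrow>
      y \<in> Field C \<Longrightarrow> (g x, g y) \<in> wcond m X"
    and "\<And>(X :: 'a rel) g x y. chain X \<Longrightarrow> convex_embedding C X g \<Longrightarrow> x \<in> Field C \<Longrightarrow>
      (g x, y) \<in> X \<Longrightarrow> y \<notin> g ` Field C \<Longrightarrow> (g x, y) \<notin> wcond m X"
  shows "solid m C"
  using assms unfolding solid_def by blast

lemma solidD: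
  fixes C X :: "'a rel"
  assumes "solid m C" "chain X" "convex_embedding C X g" "x \<in> Field C"
  shows "y \<in> Field C \<Longrightarrow> (g x, g y) \<in> wcond m X"
    and "(g x, y) \<in> X \<Longrightarrow> y \<notin> g ` Field C \<Longrightarrow> (g x, y) \<notin> wcond m X"
  using assms unfolding solid_def by blast+

lemma solid_order_iso:
  fixes C D :: "'a rel"
  assumes C: "solid m C" and D: "chain D" and iso: "C \<cong>\<^sub>o D"
  shows "solid m D"
proof -
  obtain f where f: "bij_betw f (Field C) (Field D)"
    "\<And>x y. x \<in> Field C \<Longrightarrow> y \<in> Field C \<Longrightarrow> (x, y) \<in> C \<longleftrightarrow> (f x, f y) \<in> D"
    using iso unfolding order_iso_iff by blast
  have Df: "Field D = f ` Field C"
    using f(1) by (simp add: bij_betw_def)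
  note fe = convex_embedding_of_iso[OF f]
  show ?thesis
  proof (rule solidI[OF D])
    show "Field D \<noteq> {}"
      using C Df by (simp add: solid_def)
  next
    fix X :: "'a rel" and g x y
    assume X: "chain X" and g: "convex_embedding D X g" and "x \<in> Field D" "y \<in> Field D"
    then obtain u v where "u \<in> Field C" "v \<in> Field C" "x = f u" "y = f v"
      using Df by blast
    then show "(g x, g y) \<in> wcond m X"
      using solidD(1)[OF C X convex_embedding_comp[OF fe g]] by simp
  next
    fix X :: "'a rel" and g x y
    assume X: "chain X" and g: "convex_embedding D X g" and x: "x \<in> Field D"
      and y: "(g x, y) \<in> X" "y \<notin> g ` Field D"
    obtain u where u: "u \<in> Field C" "x = f u"
      using x Df by blast
    have "y \<notin> (g \<circ> f) ` Field C"
      using y(2) Df by (simp add: image_comp)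
    then show "(g x, y) \<notin> wcond m X"
      using solidD(2)[OF C X convex_embedding_comp[OF fe g] u(1)] y(1) u(2) by simp
  qed
qed

lemma solid_rank_omega:
  assumes M: "chain M" "uniform M" "has_rank_omega M" and C: "chain C" and iso: "M \<cong>\<^sub>o C"
  shows "solid 0 C"
proof -
  obtain f where f: "bij_betw f (Field M) (Field C)"
    "\<And>x y. x \<in> Field M \<Longrightarrow> y \<in> Field M \<Longrightarrow> (x, y) \<in> M \<longleftrightarrow> (f x, f y) \<in> C"
    using iso unfolding order_iso_iff by blast
  have Cf: "Field C = f ` Field M"
    using f(1) by (simp add: bij_betw_def)
  note fe = convex_embedding_of_iso[OF f]
  show ?thesis
  proof (rule solidI[OF C])
    show "Field C \<noteq> {}"
      using rank_omegaD(1)[OF M(1,3)] Cf by simp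
  next
    fix X :: "'b rel" and g x y
    assume X: "chain X" and g: "convex_embedding C X g" and "x \<in> Field C" "y \<in> Field C"
    then obtain u v where uv: "u \<in> Field M" "v \<in> Field M" "x = f u" "y = f v"
      using Cf by blast
    then have "(u, v) \<in> wcond 0 M"
      using rank_omegaD(2)[OF M(1,3)] by blast
    then show "(g x, g y) \<in> wcond 0 X"
      using wcond_convex_embedding[OF M(1) X convex_embedding_comp[OF fe g] uv(1,2), of 0] uv(3,4)
      by (simp del: wcond.simps)
  next
    fix X :: "'b rel" and g x y
    assume X: "chain X" and g: "convex_embedding C X g" and x: "x \<in> Field C"
      and y: "(g x, y) \<in> X" "y \<notin> g ` Field C"
    obtain u where u: "u \<in> Field M" "x = f u"
      using x Cf by blast
    have "y \<notin> (g \<circ> f) ` Field M"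
      using y(2) Cf by (simp add: image_comp)
    then show "(g x, y) \<notin> wcond 0 X"
      using rank_omega_not_wcond_above[OF M X convex_embedding_comp[OF fe g] u(1)] y(1) u(2)
      by (simp del: wcond.simps)
  qed
qed

text \<open>The subchain of the points with the same value of \<open>b\<close> as \<open>x\<close>.\<close>

definition block :: "'a rel \<Rightarrow> ('a \<Rightarrow> int) \<Rightarrow> 'a \<Rightarrow> 'a rel" where
  "block A b x = Restr A {y \<in> Field A. b y = b x}"

text \<open>A chain cut into solid blocks by a monotone integer-valued function, such that every block has
  a successor. In such a chain the blocks are the condensation classes, and the chain is itself
  solid one level up, because infinitely many blocks lie above each of its points.\<close>

definition cut_into_blocks :: "nat \<Rightarrow> 'a rel \<Rightarrow> ('a \<Rightarrow> int) \<Rightarrow> bool" where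
  "cut_into_blocks m A b \<longleftrightarrow> chain A \<and> Field A \<noteq> {} \<and> (\<forall>(x, y)\<in>A. b x \<le> b y) \<and>
     (\<forall>x\<in>Field A. \<exists>y\<in>Field A. b y = b x + 1) \<and> (\<forall>x\<in>Field A. solid m (block A b x))"

lemma wcond_block_iff:
  fixes A X :: "'a rel"
  assumes cut: "cut_into_blocks m A b" and X: "chain X" and g: "convex_embedding A X g"
    and x: "x \<in> Field A" and y: "y \<in> Field A"
  shows "(g x, g y) \<in> wcond m X \<longleftrightarrow> b x = b y"
proof -
  have A: "chain A" and mono: "\<And>x y. (x, y) \<in> A \<Longrightarrow> b x \<le> b y"
    and solid: "\<And>x. x \<in> Field A \<Longrightarrow> solid m (block A b x)"
    using cut by (auto simp: cut_into_blocks_def)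
  have main: "(g x, g y) \<in> wcond m X \<longleftrightarrow> b x = b y" if xy: "(x, y) \<in> A" for x y
  proof -
    have x: "x \<in> Field A" and y: "y \<in> Field A"
      using xy by (auto intro: FieldI1 FieldI2)
    let ?S = "{y \<in> Field A. b y = b x}"
    have S: "Field (block A b x) = ?S"
      using A by (auto simp: block_def Field_Restr_chain)
    have "z \<in> ?S" if "u \<in> ?S" "v \<in> ?S" "(u, z) \<in> A" "(z, v) \<in> A" for u v z
      using that mono[of u z] mono[of z v] FieldI2[of u z A] by auto
    then have "convex_embedding (block A b x) A id"
      unfolding block_def by (rule convex_embedding_Restr[OF A, rotated]) auto
    then have e: "convex_embedding (block A b x) X g"
      using convex_embedding_comp[OF _ g] by fastforce
    show ?thesis
    proof
      assume w: "(g x, g y) \<in> wcond m X"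
      show "b x = b y"
      proof (rule ccontr)
        assume "b x \<noteq> b y"
        then have "g y \<notin> g ` ?S"
          using convex_embedding_inj[OF A X g y] by auto
        then show False
          using solidD(2)[OF solid[OF x] X e, of x "g y"] w x y g xy
          by (auto simp: S convex_embedding_def)
      qed
    next
      assume "b x = b y"
      then show "(g x, g y) \<in> wcond m X"
        using solidD(1)[OF solid[OF x] X e, of x y] x y by (simp add: S)
    qed
  qed
  show ?thesis
    using chain_linear[OF A x y] main convex_equivD(4)[OF convex_equiv_wcond[OF X]] by metis
qed

lemma solid_Suc:
  fixes A :: "'a rel"
  assumes cut: "cut_into_blocks m A b"
  shows "solid (Suc m) A"
proof -
  have A: "chain A" "Field A \<noteq> {}" and mono: "\<And>x y. (x, y) \<in> A \<Longrightarrow> b x \<le> b y"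
    and succ: "\<And>x. x \<in> Field A \<Longrightarrow> \<exists>y\<in>Field A. b y = b x + 1"
    using cut by (auto simp: cut_into_blocks_def)
  have class_eq: "wcond m X `` {g z} = wcond m X `` {g w} \<longleftrightarrow> b z = b w"
    if "chain X" "convex_embedding A X g" "z \<in> Field A" "w \<in> Field A" for X :: "'a rel" and g z w
    using wcond_block_iff[OF cut that] that
      convex_equiv_class_eq_iff[OF convex_equiv_wcond[OF that(1)], of "g z" "g w"]
    by (auto simp: convex_embedding_def)
  show ?thesis
  proof (rule solidI[OF A])
    fix X :: "'a rel" and g x y
    assume X: "chain X" and g: "convex_embedding A X g" and x: "x \<in> Field A" and y: "y \<in> Field A"
    let ?I = "interval_between A x y"
    have "b ` ?I \<subseteq> {min (b x) (b y)..max (b x) (b y)}"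
      by (auto simp: interval_between_def dest!: mono)
    then have "finite (b ` ?I)"
      by (rule finite_subset) simp
    then have "finite ((\<lambda>z. wcond m X `` {g z}) ` ?I)"
      by (rule finite_image_factor) (simp add: class_eq[OF X g] interval_between_def)
    then have "finite ((\<lambda>z. wcond m X `` {z}) ` interval_between X (g x) (g y))"
      using interval_between_image[OF g x y] by (simp add: image_image)
    then show "(g x, g y) \<in> wcond (Suc m) X"
      using g x y by (simp add: cond_def convex_embedding_def)
  next
    fix X :: "'a rel" and g x y
    assume X: "chain X" and g: "convex_embedding A X g" and x: "x \<in> Field A"
      and xy: "(g x, y) \<in> X" and y: "y \<notin> g ` Field A"
    let ?S = "{z. (x, z) \<in> A}"
    have SF: "z \<in> Field A" if "z \<in> ?S" for z
      using that by (auto intro: FieldI2)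
    have "b x + int k \<in> b ` ?S" for k
    proof (induction k)
      case 0
      then show ?case
        using chain_refl[OF A(1) x] by auto
    next
      case (Suc k)
      then obtain z where z: "(x, z) \<in> A" "b z = b x + int k"
        by auto
      obtain w where w: "w \<in> Field A" "b w = b z + 1"
        using succ[OF FieldI2[OF z(1)]] by blast
      have "(w, x) \<notin> A"
        using mono[of w x] w z by auto
      then have "(x, w) \<in> A"
        using chain_linear[OF A(1) x w(1)] by blast
      then show ?case
        using w z by force
    qed
    then have "range (\<lambda>k. b x + int k) \<subseteq> b ` ?S"
      by blast
    moreover have "infinite (range (\<lambda>k. b x + int k))"
      by (rule range_inj_infinite) (simp add: inj_def)
    ultimately have inf: "infinite (b ` ?S)"
      using finite_subset by blast
    have "(g z, y) \<in> X \<and> (g x, g z) \<in> X" if z: "z \<in> ?S" for z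
    proof -
      have "(y, g z) \<notin> X"
        using g x SF[OF z] xy y unfolding convex_embedding_def by blast
      then show ?thesis
        using chain_linear[OF X _ FieldI2[OF xy], of "g z"] g x z SF[OF z]
        by (auto simp: convex_embedding_def)
    qed
    then have sub: "g ` ?S \<subseteq> interval_between X (g x) y"
      by (auto simp: interval_between_def intro: FieldI1)
    show "(g x, y) \<notin> wcond (Suc m) X"
    proof
      assume "(g x, y) \<in> wcond (Suc m) X"
      then have "finite ((\<lambda>z. wcond m X `` {z}) ` interval_between X (g x) y)"
        by (simp add: cond_def)
      then have "finite ((\<lambda>z. wcond m X `` {z}) ` g ` ?S)"
        by (rule rev_finite_subset) (use sub in blast)
      then have "finite ((\<lambda>z. wcond m X `` {g z}) ` ?S)"
        by (simp add: image_image)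
      then have "finite (b ` ?S)"
        by (rule finite_image_factor) (use class_eq[OF X g] SF in blast)
      with inf show False
        by blast
    qed
  qed
qed


section \<open>Sums and products of chains\<close>

lemma dir_image_iff: "inj f \<Longrightarrow> (f x, f y) \<in> dir_image A f \<longleftrightarrow> (x, y) \<in> A"
  by (auto simp: dir_image_def inj_def)

lemma dir_image_order_iso: "inj f \<Longrightarrow> A \<cong>\<^sub>o dir_image A f"
  unfolding order_iso_iff
  by (intro exI[of _ f]) (auto simp: dir_image_Field dir_image_iff bij_betw_def intro: inj_on_subset)

lemma Field_int_chain: "Field int_chain = UNIV"
  and Field_nat_chain: "Field nat_chain = UNIV"
  by (auto simp: int_chain_def nat_chain_def Field_def)

lemma chain_int_chain: "chain int_chain" and chain_nat_chain: "chain nat_chain"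
  by (rule chainI; auto simp: int_chain_def nat_chain_def)+

lemma chain_times_iff:
  "((x, i), (y, j)) \<in> chain_times A I \<longleftrightarrow>
     i \<in> Field I \<and> j \<in> Field I \<and> x \<in> Field A \<and> y \<in> Field A \<and>
     (i \<noteq> j \<and> (i, j) \<in> I \<or> i = j \<and> (x, y) \<in> A)"
  by (auto simp: chain_times_def chain_sum_def)

lemma Field_chain_times:
  assumes "chain A"
  shows "Field (chain_times A I) = Field A \<times> Field I"
proof
  show "Field (chain_times A I) \<subseteq> Field A \<times> Field I"
    by (auto simp: Field_def[of "chain_times A I"] chain_times_iff)
  show "Field A \<times> Field I \<subseteq> Field (chain_times A I)"
  proof
    fix p assume p: "p \<in> Field A \<times> Field I"
    then have "(p, p) \<in> chain_times A I"
      using chain_refl[OF assms] by (cases p) (simp add: chain_times_iff)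
    then show "p \<in> Field (chain_times A I)" by (rule FieldI1)
  qed
qed

lemma chain_chain_times:
  assumes A: "chain A" and I: "chain I"
  shows "chain (chain_times A I)"
proof (rule chainI)
  fix p assume "p \<in> Field (chain_times A I)"
  then show "(p, p) \<in> chain_times A I"
    using chain_refl[OF A] by (cases p) (simp add: Field_chain_times[OF A] chain_times_iff)
next
  fix p q r assume pq: "(p, q) \<in> chain_times A I" and qr: "(q, r) \<in> chain_times A I"
  obtain x i y j z k where [simp]: "p = (x, i)" "q = (y, j)" "r = (z, k)"
    by (cases p, cases q, cases r) auto
  show "(p, r) \<in> chain_times A I"
    using pq qr chain_trans[OF A, of x y z] chain_trans[OF I, of i j k]
      chain_antisym[OF I, of i j]
    by (auto simp: chain_times_iff)
next
  fix p q assume "(p, q) \<in> chain_times A I" "(q, p) \<in> chain_times A I"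
  then show "p = q"
    using chain_antisym[OF A] chain_antisym[OF I]
    by (cases p, cases q) (auto simp: chain_times_iff)
next
  fix p q assume "p \<in> Field (chain_times A I)" "q \<in> Field (chain_times A I)"
  then show "(p, q) \<in> chain_times A I \<or> (q, p) \<in> chain_times A I"
    using chain_linear[OF A, of "fst p" "fst q"] chain_linear[OF I, of "snd p" "snd q"]
    by (cases p, cases q) (auto simp: Field_chain_times[OF A] chain_times_iff)
qed

lemma chain_plus_iff:
  "(Inl x, Inl y) \<in> chain_plus A B \<longleftrightarrow> (x, y) \<in> A"
  "(Inr u, Inr v) \<in> chain_plus A B \<longleftrightarrow> (u, v) \<in> B"
  "(Inl x, Inr v) \<in> chain_plus A B \<longleftrightarrow> x \<in> Field A \<and> v \<in> Field B"
  "(Inr u, Inl y) \<notin> chain_plus A B"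
  by (auto simp: chain_plus_def)

lemma Field_chain_plus: "Field (chain_plus A B) = Field A <+> Field B"
proof -
  have Fp: "p \<in> Field (chain_plus A B) \<longleftrightarrow>
      (\<exists>y. (p, Inl y) \<in> chain_plus A B \<or> (Inl y, p) \<in> chain_plus A B) \<or>
      (\<exists>y. (p, Inr y) \<in> chain_plus A B \<or> (Inr y, p) \<in> chain_plus A B)" for p
    by (simp add: Field_def Domain_iff Range_iff split_sum_ex) blast
  have "Inl x \<in> Field (chain_plus A B) \<longleftrightarrow> x \<in> Field A" for x
    unfolding Fp chain_plus_iff by (auto simp: Field_def[of A] chain_plus_iff)
  moreover have "Inr u \<in> Field (chain_plus A B) \<longleftrightarrow> u \<in> Field B" for u
    unfolding Fp chain_plus_iff by (auto simp: Field_def[of B] chain_plus_iff)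
  ultimately have "p \<in> Field (chain_plus A B) \<longleftrightarrow> p \<in> Field A <+> Field B" for p
    by (cases p) (auto simp: Plus_def)
  then show ?thesis by blast
qed

lemma chain_chain_plus:
  assumes A: "chain A" and B: "chain B"
  shows "chain (chain_plus A B)"
proof (rule chainI)
  fix p assume "p \<in> Field (chain_plus A B)"
  then show "(p, p) \<in> chain_plus A B"
    using chain_refl[OF A] chain_refl[OF B] by (auto simp: Field_chain_plus chain_plus_iff)
next
  fix p q r assume pq: "(p, q) \<in> chain_plus A B" and qr: "(q, r) \<in> chain_plus A B"
  have FA: "x \<in> Field A" "y \<in> Field A" if "(x, y) \<in> A" for x y
    using that by (auto intro: FieldI1 FieldI2)
  have FB: "x \<in> Field B" "y \<in> Field B" if "(x, y) \<in> B" for x y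
    using that by (auto intro: FieldI1 FieldI2)
  show "(p, r) \<in> chain_plus A B"
    using pq qr
    by (cases p; cases q; cases r)
      (auto simp: chain_plus_iff dest: FA FB elim: chain_trans[OF A] chain_trans[OF B])
next
  fix p q assume "(p, q) \<in> chain_plus A B" "(q, p) \<in> chain_plus A B"
  then show "p = q"
    using chain_antisym[OF A] chain_antisym[OF B]
    by (cases p; cases q) (simp_all add: chain_plus_iff)
next
  fix p q assume "p \<in> Field (chain_plus A B)" "q \<in> Field (chain_plus A B)"
  then show "(p, q) \<in> chain_plus A B \<or> (q, p) \<in> chain_plus A B"
    by (auto simp: Field_chain_plus chain_plus_iff dest: chain_linear[OF A] chain_linear[OF B])
qed

text \<open>The number of the copy of a summand in which a point of \<open>B \<int>\<close> or \<open>B + C \<nat>\<close> lies; in the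
  latter chain \<open>B\<close> has number 0 and the copies of \<open>C\<close> are counted from 1.\<close>

fun block_index :: "'a point \<Rightarrow> int" where
  "block_index (Base a) = 0"
| "block_index (Times_Z (u, i)) = i"
| "block_index (Plus_Times_N (Inl u)) = 0"
| "block_index (Plus_Times_N (Inr (u, k))) = int k + 1"

lemma inj_point: "inj Base" "inj Times_Z" "inj Plus_Times_N"
  by (simp_all add: inj_def)

lemma block_order_isoI:
  assumes A: "chain A" and B: "chain B"
    and im: "f ` Field B = {y \<in> Field A. b y = b x}"
    and f: "\<And>u v. u \<in> Field B \<Longrightarrow> v \<in> Field B \<Longrightarrow> (u, v) \<in> B \<longleftrightarrow> (f u, f v) \<in> A"
  shows "block A b x \<cong>\<^sub>o B"
proof -
  let ?S = "{y \<in> Field A. b y = b x}"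
  have "inj_on f (Field B)"
    using f chain_refl[OF B] chain_antisym[OF B] by (metis inj_onI)
  then have "bij_betw f (Field B) ?S"
    using im by (simp add: bij_betw_def)
  then have "Restr B (Field B) \<cong>\<^sub>o Restr A ?S"
    by (intro Restr_order_isoI[OF B A]) (use f in auto)
  moreover have "Restr B (Field B) = B"
    by (auto intro: FieldI1 FieldI2)
  ultimately show ?thesis
    unfolding block_def by (simp add: order_iso_sym)
qed

lemma blocks_times_int:
  fixes B A :: "'a point rel"
  assumes B: "chain B" "Field B \<noteq> {}"
    and A_eq: "A = dir_image (chain_times B int_chain) Times_Z"
  shows Field_times_int: "Field A = Times_Z ` (Field B \<times> UNIV)"
    and block_times_int: "x \<in> Field A \<Longrightarrow> block A block_index x \<cong>\<^sub>o B"
    and cut_times_int: "solid m B \<Longrightarrow> cut_into_blocks m A block_index"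
proof -
  have A: "chain A"
    unfolding A_eq by (intro Linear_order_dir_image chain_chain_times B chain_int_chain)
      (auto intro: inj_on_subset[OF inj_point(2)])
  show F: "Field A = Times_Z ` (Field B \<times> UNIV)"
    by (simp add: A_eq dir_image_Field Field_chain_times[OF B(1)] Field_int_chain)
  have iff: "(Times_Z (u, i), Times_Z (v, j)) \<in> A \<longleftrightarrow>
      u \<in> Field B \<and> v \<in> Field B \<and> (i < j \<or> i = j \<and> (u, v) \<in> B)" for u i v j
    by (auto simp: A_eq dir_image_iff[OF inj_point(2)] chain_times_iff Field_int_chain)
      (auto simp: int_chain_def)
  have mono: "block_index x \<le> block_index y" if "(x, y) \<in> A" for x y
    using FieldI1[OF that] FieldI2[OF that] that by (auto simp: F iff)
  show blk: "block A block_index x \<cong>\<^sub>o B" if x: "x \<in> Field A" for x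
    by (rule block_order_isoI[OF A B(1), where f = "\<lambda>u. Times_Z (u, block_index x)"])
      (auto simp: F iff)
  show "cut_into_blocks m A block_index" if "solid m B"
    unfolding cut_into_blocks_def
  proof (intro conjI ballI)
    show "Field A \<noteq> {}"
      using B(2) by (auto simp: F)
    show "\<exists>y\<in>Field A. block_index y = block_index x + 1" if "x \<in> Field A" for x
      using that by (force simp: F)
    show "solid m (block A block_index x)" if "x \<in> Field A" for x
      by (rule solid_order_iso[OF \<open>solid m B\<close> _ order_iso_sym[OF blk[OF that]]])
        (simp add: block_def A Linear_order_Restr)
  qed (use A mono in auto)
qed

lemma blocks_plus_times_nat:
  fixes B C A :: "'a point rel"
  assumes B: "chain B" "Field B \<noteq> {}" and C: "chain C" "Field C \<noteq> {}"
    and A_eq: "A = dir_image (chain_plus B (chain_times C nat_chain)) Plus_Times_N"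
  shows Field_plus_times_nat: "Field A = Plus_Times_N ` (Field B <+> Field C \<times> UNIV)"
    and block_0_plus_times_nat:
      "x \<in> Field A \<Longrightarrow> block_index x = 0 \<Longrightarrow> block A block_index x \<cong>\<^sub>o B"
    and block_Suc_plus_times_nat:
      "x \<in> Field A \<Longrightarrow> block_index x \<noteq> 0 \<Longrightarrow> block A block_index x \<cong>\<^sub>o C"
    and cut_plus_times_nat: "solid m B \<Longrightarrow> solid m C \<Longrightarrow> cut_into_blocks m A block_index"
proof -
  have A: "chain A"
    unfolding A_eq
    by (intro Linear_order_dir_image chain_chain_plus chain_chain_times B C chain_nat_chain)
      (auto intro: inj_on_subset[OF inj_point(3)])
  show F: "Field A = Plus_Times_N ` (Field B <+> Field C \<times> UNIV)"
    by (simp add: A_eq dir_image_Field Field_chain_plus Field_chain_times[OF C(1)] Field_nat_chain)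
  have iff: "(Plus_Times_N p, Plus_Times_N q) \<in> A \<longleftrightarrow> (p, q) \<in> chain_plus B (chain_times C nat_chain)"
    for p q
    by (simp add: A_eq dir_image_iff[OF inj_point(3)])
  have iff': "((u, i), (v, j)) \<in> chain_times C nat_chain \<longleftrightarrow>
      u \<in> Field C \<and> v \<in> Field C \<and> (i < j \<or> i = j \<and> (u, v) \<in> C)" for u i v j
    by (auto simp: chain_times_iff Field_nat_chain) (auto simp: nat_chain_def)
  have mono: "block_index x \<le> block_index y" if "(x, y) \<in> A" for x y
    using FieldI1[OF that] FieldI2[OF that] that by (auto simp: F iff chain_plus_iff iff')
  show blk0: "block A block_index x \<cong>\<^sub>o B" if x: "x \<in> Field A" "block_index x = 0" for x
    by (rule block_order_isoI[OF A B(1), where f = "\<lambda>u. Plus_Times_N (Inl u)"])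
      (use x in \<open>auto simp: F iff chain_plus_iff\<close>)
  show blk1: "block A block_index x \<cong>\<^sub>o C" if x: "x \<in> Field A" "block_index x \<noteq> 0" for x
    by (rule block_order_isoI[OF A C(1),
          where f = "\<lambda>u. Plus_Times_N (Inr (u, nat (block_index x - 1)))"])
      (use x in \<open>auto simp: F iff chain_plus_iff iff'\<close>)
  show "cut_into_blocks m A block_index" if sol: "solid m B" "solid m C"
    unfolding cut_into_blocks_def
  proof (intro conjI ballI)
    show "Field A \<noteq> {}"
      using B(2) by (auto simp: F)
    obtain c where c: "c \<in> Field C"
      using C(2) by blast
    show "\<exists>y\<in>Field A. block_index y = block_index x + 1" if x: "x \<in> Field A" for x
      by (rule bexI[of _ "Plus_Times_N (Inr (c, nat (block_index x)))"])
        (use x c in \<open>auto simp: F\<close>)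
    show "solid m (block A block_index x)" if x: "x \<in> Field A" for x
    proof -
      have "chain (block A block_index x)"
        by (simp add: block_def A Linear_order_Restr)
      then show ?thesis
        using solid_order_iso[OF sol(1) _ order_iso_sym[OF blk0[OF x]]]
          solid_order_iso[OF sol(2) _ order_iso_sym[OF blk1[OF x]]] by blast
    qed
  qed (use A mono in auto)
qed

section \<open>The blocks of the chain of a sequence\<close>

text \<open>The chains at the leaves of the right subtree, which enter the summand \<open>\<A>(s\<^sup>-) \<nat>\<close>.\<close>

abbreviation right_part :: "nat list \<Rightarrow> (nat \<Rightarrow> 'a rel) \<Rightarrow> nat \<Rightarrow> 'a rel" where
  "right_part s M \<equiv> (\<lambda>i. M (\<ell> (seq_plus s) + i))"

text \<open>The data from which \<open>\<A>(s)\<close> is built: a sequence of length \<open>m + 1\<close>, not \<open>m\<close>, and a uniform chain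
  of rank \<open>\<omega>\<close> for each leaf.\<close>

definition admissible :: "nat \<Rightarrow> nat list \<Rightarrow> (nat \<Rightarrow> 'a rel) \<Rightarrow> bool" where
  "admissible m s M \<longleftrightarrow> s \<in> \<S> (Suc m) \<and>
     (\<forall>i<\<ell> s. chain (M i) \<and> uniform (M i) \<and> has_rank_omega (M i))"

lemma num_leaves_eq:
  assumes "s \<in> \<S> (Suc (Suc m))" "last s = Suc m"
  shows "\<ell> s = \<ell> (seq_minus s)"
  using leaves_eq[OF assms(1)] last_in_\<S>[OF assms(1)] assms(2) by (simp add: num_leaves_def)

lemma num_leaves_neq:
  assumes "s \<in> \<S> (Suc (Suc m))" "last s \<noteq> Suc m"
  shows "\<ell> s = \<ell> (seq_plus s) + \<ell> (seq_minus s)"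
  using num_leaves_less[OF assms(1)] last_in_\<S>[OF assms(1)] assms(2) by simp

lemma seq_plus_in:
  assumes "s \<in> \<S> (Suc (Suc m))" "last s \<noteq> Suc m"
  shows "seq_plus s \<in> \<S> (Suc m)"
  using seq_plus_in_iff[OF assms(1)] last_in_\<S>[OF assms(1)] assms(2) by simp

lemma num_leaves_pos: "s \<in> \<S> (Suc m) \<Longrightarrow> 0 < \<ell> s"
  using leaves_label[of s m] by (auto simp: num_leaves_def)

lemma admissible_minus_eq:
  "admissible (Suc m) s M \<Longrightarrow> last s = Suc m \<Longrightarrow> admissible m (seq_minus s) M"
  using num_leaves_eq seq_minus_in by (auto simp: admissible_def)

lemma admissible_plus:
  "admissible (Suc m) s M \<Longrightarrow> last s \<noteq> Suc m \<Longrightarrow> admissible m (seq_plus s) M"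
  using num_leaves_neq seq_plus_in by (auto simp: admissible_def)

lemma admissible_minus_neq:
  "admissible (Suc m) s M \<Longrightarrow> last s \<noteq> Suc m \<Longrightarrow> admissible m (seq_minus s) (right_part s M)"
  using num_leaves_neq seq_minus_in by (auto simp: admissible_def)

lemma \<A>_single: "s \<in> \<S> (Suc 0) \<Longrightarrow> \<A> s M = dir_image (M 0) Base"
  by (subst \<A>.simps) (simp add: \<S>_def)

lemma \<A>_eq:
  assumes "s \<in> \<S> (Suc (Suc m))" "last s = Suc m"
  shows "\<A> s M = dir_image (chain_times (\<A> (seq_minus s) M) int_chain) Times_Z"
  by (subst \<A>.simps) (use assms in \<open>simp add: \<S>_def\<close>)

lemma \<A>_neq:
  assumes "s \<in> \<S> (Suc (Suc m))" "last s \<noteq> Suc m"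
  shows "\<A> s M = dir_image (chain_plus (\<A> (seq_plus s) M)
    (chain_times (\<A> (seq_minus s) (right_part s M)) nat_chain)) Plus_Times_N"
  by (subst \<A>.simps) (use assms in \<open>simp add: \<S>_def\<close>)

lemma solidE: "solid m C \<Longrightarrow> chain C" "solid m C \<Longrightarrow> Field C \<noteq> {}"
  by (simp_all add: solid_def)

lemma solid_\<A>: "admissible m s M \<Longrightarrow> solid m (\<A> s M)"
proof (induction m arbitrary: s M)
  case 0
  then have s: "s \<in> \<S> (Suc 0)"
    by (simp add: admissible_def)
  have M: "chain (M 0)" "uniform (M 0)" "has_rank_omega (M 0)"
    using 0 num_leaves_pos[OF s] by (auto simp: admissible_def)
  show ?case
    unfolding \<A>_single[OF s]
    by (rule solid_rank_omega[OF M])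
      (auto intro!: Linear_order_dir_image M dir_image_order_iso inj_point
        inj_on_subset[OF inj_point(1)])
next
  case (Suc m)
  then have s: "s \<in> \<S> (Suc (Suc m))"
    by (simp add: admissible_def)
  show ?case
  proof (cases "last s = Suc m")
    case True
    note sol = Suc.IH[OF admissible_minus_eq[OF Suc.prems True]]
    show ?thesis
      by (rule solid_Suc[OF cut_times_int[OF solidE[OF sol] \<A>_eq[OF s True] sol]])
  next
    case False
    note sol1 = Suc.IH[OF admissible_plus[OF Suc.prems False]]
    note sol2 = Suc.IH[OF admissible_minus_neq[OF Suc.prems False]]
    show ?thesis
      by (rule solid_Suc[OF cut_plus_times_nat[OF solidE[OF sol1] solidE[OF sol2]
              \<A>_neq[OF s False] sol1 sol2]])
  qed
qed

lemmas chain_\<A> = solidE(1)[OF solid_\<A>] and \<A>_nonempty = solidE(2)[OF solid_\<A>]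

text \<open>The subchain on the \<open>wcond m\<close>-class of a point, and the points of the least class.\<close>

definition cls :: "nat \<Rightarrow> 'a rel \<Rightarrow> 'a \<Rightarrow> 'a rel" where
  "cls m A x = Restr A (wcond m A `` {x})"

definition lowest :: "nat \<Rightarrow> 'a rel \<Rightarrow> 'a \<Rightarrow> bool" where
  "lowest m A x \<longleftrightarrow> (\<forall>y. (y, x) \<in> A \<longrightarrow> (y, x) \<in> wcond m A)"

lemma cut_into_blocks_class:
  fixes A :: "'a rel"
  assumes cut: "cut_into_blocks m A b"
  shows cls_eq_block: "x \<in> Field A \<Longrightarrow> cls m A x = block A b x"
    and lowest_iff_block: "x \<in> Field A \<Longrightarrow> lowest m A x \<longleftrightarrow> (\<forall>y\<in>Field A. b x \<le> b y)"
    and higher_class: "x \<in> Field A \<Longrightarrow> \<exists>y. (x, y) \<in> A \<and> (x, y) \<notin> wcond m A"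
proof -
  have A: "chain A" and mono: "\<And>x y. (x, y) \<in> A \<Longrightarrow> b x \<le> b y"
    and succ: "\<And>x. x \<in> Field A \<Longrightarrow> \<exists>y\<in>Field A. b y = b x + 1"
    using cut by (auto simp: cut_into_blocks_def)
  have iff: "(x, y) \<in> wcond m A \<longleftrightarrow> b x = b y" if "x \<in> Field A" "y \<in> Field A" for x y
    using wcond_block_iff[OF cut A convex_embedding_id that] by simp
  have "wcond m A \<subseteq> Field A \<times> Field A"
    using convex_equiv_wcond[OF A] by (simp add: convex_equiv_def)
  then show "cls m A x = block A b x" if "x \<in> Field A" for x
    unfolding cls_def block_def using iff[OF that] by auto
  show "lowest m A x \<longleftrightarrow> (\<forall>y\<in>Field A. b x \<le> b y)" if x: "x \<in> Field A" for x
  proof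
    assume l: "lowest m A x"
    show "\<forall>y\<in>Field A. b x \<le> b y"
    proof
      fix y assume y: "y \<in> Field A"
      show "b x \<le> b y"
        using chain_linear[OF A x y] mono l iff[OF y x] by (auto simp: lowest_def)
    qed
  next
    assume r: "\<forall>y\<in>Field A. b x \<le> b y"
    show "lowest m A x"
      unfolding lowest_def
    proof (intro allI impI)
      fix y assume yx: "(y, x) \<in> A"
      then have y: "y \<in> Field A" by (rule FieldI1)
      show "(y, x) \<in> wcond m A"
        using iff[OF y x] mono[OF yx] r y by fastforce
    qed
  qed
  show "\<exists>y. (x, y) \<in> A \<and> (x, y) \<notin> wcond m A" if x: "x \<in> Field A" for x
  proof -
    obtain y where y: "y \<in> Field A" "b y = b x + 1"
      using succ[OF x] by blast
    then have "(y, x) \<notin> A"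
      using mono[of y x] by auto
    then show ?thesis
      using chain_linear[OF A x y(1)] iff[OF x y(1)] y(2) by auto
  qed
qed

text \<open>The classes of \<open>\<A>(s)\<close> one level below its own rank. If the last entry of \<open>s\<close> is maximal
  they are copies of \<open>\<A>(s\<^sup>-)\<close> and there is no least one; otherwise the least one is \<open>\<A>(s\<^sup>+)\<close> and the
  others are copies of \<open>\<A>(s\<^sup>-)\<close>.\<close>

lemma \<A>_classes_eq:
  assumes adm: "admissible (Suc m) s M" and last: "last s = Suc m"
    and x: "x \<in> Field (\<A> s M)"
  shows "cls m (\<A> s M) x \<cong>\<^sub>o \<A> (seq_minus s) M"
    and "\<not> lowest m (\<A> s M) x"
    and "\<exists>y. (x, y) \<in> \<A> s M \<and> (x, y) \<notin> wcond m (\<A> s M)"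
proof -
  have s: "s \<in> \<S> (Suc (Suc m))"
    using adm by (simp add: admissible_def)
  note sol = solid_\<A>[OF admissible_minus_eq[OF adm last]]
  note B = solidE[OF sol] \<A>_eq[OF s last]
  note cut = cut_times_int[OF B sol]
  show "cls m (\<A> s M) x \<cong>\<^sub>o \<A> (seq_minus s) M"
    using block_times_int[OF B x] cls_eq_block[OF cut x] by simp
  show "\<exists>y. (x, y) \<in> \<A> s M \<and> (x, y) \<notin> wcond m (\<A> s M)"
    by (rule higher_class[OF cut x])
  obtain u where "u \<in> Field (\<A> (seq_minus s) M)"
    using B(2) by blast
  then have "Times_Z (u, block_index x - 1) \<in> Field (\<A> s M)"
    unfolding Field_times_int[OF B] by blast
  then show "\<not> lowest m (\<A> s M) x"
    unfolding lowest_iff_block[OF cut x] by force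
qed

lemma \<A>_classes_neq:
  assumes adm: "admissible (Suc m) s M" and last: "last s \<noteq> Suc m"
  shows "x \<in> Field (\<A> s M) \<Longrightarrow> lowest m (\<A> s M) x \<Longrightarrow> cls m (\<A> s M) x \<cong>\<^sub>o \<A> (seq_plus s) M"
    and "x \<in> Field (\<A> s M) \<Longrightarrow> \<not> lowest m (\<A> s M) x \<Longrightarrow>
      cls m (\<A> s M) x \<cong>\<^sub>o \<A> (seq_minus s) (right_part s M)"
    and "\<exists>x\<in>Field (\<A> s M). lowest m (\<A> s M) x"
    and "x \<in> Field (\<A> s M) \<Longrightarrow> \<exists>y. (x, y) \<in> \<A> s M \<and> (x, y) \<notin> wcond m (\<A> s M)"
proof -
  have s: "s \<in> \<S> (Suc (Suc m))"
    using adm by (simp add: admissible_def)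
  note sol1 = solid_\<A>[OF admissible_plus[OF adm last]]
  note sol2 = solid_\<A>[OF admissible_minus_neq[OF adm last]]
  note B = solidE[OF sol1] solidE[OF sol2] \<A>_neq[OF s last]
  note cut = cut_plus_times_nat[OF B sol1 sol2]
  have nonneg: "0 \<le> block_index y" if "y \<in> Field (\<A> s M)" for y
    using that unfolding Field_plus_times_nat[OF B] by auto
  obtain u where "u \<in> Field (\<A> (seq_plus s) M)"
    using B(2) by blast
  then have u: "Plus_Times_N (Inl u) \<in> Field (\<A> s M)"
    unfolding Field_plus_times_nat[OF B] by blast
  have low: "lowest m (\<A> s M) y \<longleftrightarrow> block_index y = 0" if "y \<in> Field (\<A> s M)" for y
    unfolding lowest_iff_block[OF cut that]
  proof
    assume "\<forall>z\<in>Field (\<A> s M). block_index y \<le> block_index z"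
    from bspec[OF this u] nonneg[OF that] show "block_index y = 0"
      by simp
  qed (use nonneg in simp)
  show "cls m (\<A> s M) x \<cong>\<^sub>o \<A> (seq_plus s) M"
    if "x \<in> Field (\<A> s M)" "lowest m (\<A> s M) x"
    unfolding cls_eq_block[OF cut that(1)]
    by (rule block_0_plus_times_nat[OF B that(1)]) (use low[OF that(1)] that(2) in blast)
  show "cls m (\<A> s M) x \<cong>\<^sub>o \<A> (seq_minus s) (right_part s M)"
    if "x \<in> Field (\<A> s M)" "\<not> lowest m (\<A> s M) x"
    unfolding cls_eq_block[OF cut that(1)]
    by (rule block_Suc_plus_times_nat[OF B that(1)]) (use low[OF that(1)] that(2) in blast)
  show "\<exists>x\<in>Field (\<A> s M). lowest m (\<A> s M) x"
    using low[OF u] u by (intro bexI[OF _ u]) simp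
  show "\<exists>y. (x, y) \<in> \<A> s M \<and> (x, y) \<notin> wcond m (\<A> s M)" if "x \<in> Field (\<A> s M)"
    by (rule higher_class[OF cut that])
qed


section \<open>Isomorphisms permute the classes\<close>

lemma Field_cls:
  assumes "chain A"
  shows "Field (cls m A x) = wcond m A `` {x}"
proof -
  have "wcond m A `` {x} \<subseteq> Field A"
    using convex_equivD(2)[OF convex_equiv_wcond[OF assms]] by blast
  then show ?thesis
    using assms by (auto simp: cls_def Field_Restr_chain)
qed

lemma chain_cls: "chain A \<Longrightarrow> chain (cls m A x)"
  unfolding cls_def by (rule Linear_order_Restr)

lemma iso_classes:
  assumes A: "chain A" and B: "chain B" and f: "bij_betw f (Field A) (Field B)"
    "\<And>x y. x \<in> Field A \<Longrightarrow> y \<in> Field A \<Longrightarrow> (x, y) \<in> A \<longleftrightarrow> (f x, f y) \<in> B"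
    and x: "x \<in> Field A"
  shows cls_iso: "cls m A x \<cong>\<^sub>o cls m B (f x)"
    and lowest_iso: "lowest m A x \<longleftrightarrow> lowest m B (f x)"
proof -
  have W: "(u, v) \<in> wcond m A \<longleftrightarrow> (f u, f v) \<in> wcond m B" if "u \<in> Field A" "v \<in> Field A" for u v
    by (rule wcond_convex_embedding[OF A B convex_embedding_of_iso[OF f] that])
  have sub: "wcond m A `` {x} \<subseteq> Field A" "wcond m B `` {f x} \<subseteq> Field B"
    using convex_equivD(2)[OF convex_equiv_wcond[OF A]]
      convex_equivD(2)[OF convex_equiv_wcond[OF B]] by blast+
  have Bf: "Field B = f ` Field A"
    using f(1) by (simp add: bij_betw_def)
  have "f ` (wcond m A `` {x}) = wcond m B `` {f x}"
  proof
    show "f ` (wcond m A `` {x}) \<subseteq> wcond m B `` {f x}"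
      using W[OF x] sub(1) by blast
    show "wcond m B `` {f x} \<subseteq> f ` (wcond m A `` {x})"
    proof
      fix v assume v: "v \<in> wcond m B `` {f x}"
      then obtain u where "u \<in> Field A" "v = f u"
        using sub(2) Bf by blast
      then show "v \<in> f ` (wcond m A `` {x})"
        using v W[OF x] by blast
    qed
  qed
  moreover have "inj_on f (wcond m A `` {x})"
    using bij_betw_imp_inj_on[OF f(1)] sub(1) by (rule inj_on_subset)
  ultimately have "bij_betw f (wcond m A `` {x}) (wcond m B `` {f x})"
    by (simp add: bij_betw_def)
  then show "cls m A x \<cong>\<^sub>o cls m B (f x)"
    unfolding cls_def using Restr_order_isoI[OF A B sub] f(2) sub(1) by blast
  show "lowest m A x \<longleftrightarrow> lowest m B (f x)"
  proof
    assume l: "lowest m A x"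
    show "lowest m B (f x)"
      unfolding lowest_def
    proof (intro allI impI)
      fix v assume v: "(v, f x) \<in> B"
      then obtain u where u: "u \<in> Field A" "v = f u"
        using FieldI1[OF v] Bf by blast
      then show "(v, f x) \<in> wcond m B"
        using v f(2)[OF u(1) x] W[OF u(1) x] l by (simp add: lowest_def)
    qed
  next
    assume l: "lowest m B (f x)"
    show "lowest m A x"
      unfolding lowest_def
    proof (intro allI impI)
      fix u assume u: "(u, x) \<in> A"
      show "(u, x) \<in> wcond m A"
        using u f(2)[OF FieldI1[OF u] x] W[OF FieldI1[OF u] x] l by (simp add: lowest_def)
    qed
  qed
qed

text \<open>The chains \<open>M\<^sub>i\<close> from which the classes of \<open>\<A>(s)\<close> other than the least one are built; these
  classes are copies of \<open>\<A>(s\<^sup>-)\<close> in either case.\<close>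

definition upper_leaves :: "nat list \<Rightarrow> (nat \<Rightarrow> 'a rel) \<Rightarrow> nat \<Rightarrow> 'a rel" where
  "upper_leaves s M = (if last s = length s - 1 then M else right_part s M)"

lemma upper_leaves_eq:
  "admissible (Suc m) s M \<Longrightarrow> upper_leaves s M = (if last s = Suc m then M else right_part s M)"
  by (simp add: upper_leaves_def admissible_def \<S>_def)

lemma admissible_upper:
  "admissible (Suc m) s M \<Longrightarrow> admissible m (seq_minus s) (upper_leaves s M)"
  using admissible_minus_eq admissible_minus_neq
  by (cases "last s = Suc m") (simp_all add: upper_leaves_eq)

lemma upper_class:
  "admissible (Suc m) s M \<Longrightarrow> x \<in> Field (\<A> s M) \<Longrightarrow> \<not> lowest m (\<A> s M) x \<Longrightarrow>
    cls m (\<A> s M) x \<cong>\<^sub>o \<A> (seq_minus s) (upper_leaves s M)"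
  using \<A>_classes_eq(1) \<A>_classes_neq(2)
  by (cases "last s = Suc m") (simp_all add: upper_leaves_eq)

lemma lowest_exists_iff:
  "admissible (Suc m) s M \<Longrightarrow> (\<exists>x\<in>Field (\<A> s M). lowest m (\<A> s M) x) \<longleftrightarrow> last s \<noteq> Suc m"
  using \<A>_classes_eq(2) \<A>_classes_neq(3) by (cases "last s = Suc m") blast+

lemma higher_point:
  "admissible (Suc m) s M \<Longrightarrow> x \<in> Field (\<A> s M) \<Longrightarrow>
    \<exists>y. (x, y) \<in> \<A> s M \<and> (x, y) \<notin> wcond m (\<A> s M)"
  using \<A>_classes_eq(3) \<A>_classes_neq(4) by (cases "last s = Suc m") blast+

lemma not_lowest: "(x, y) \<in> A \<Longrightarrow> (x, y) \<notin> wcond m A \<Longrightarrow> \<not> lowest m A y"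
  by (auto simp: lowest_def)

text \<open>The chain determines its summands: an isomorphism matches least classes with least classes
  and the others with the others, and by induction on the length it matches the leaves in order.\<close>

lemma \<A>_iso_imp_leaves_iso:
  assumes "admissible m s M" "admissible m t N" "\<A> s M \<cong>\<^sub>o \<A> t N"
  shows "\<ell> s = \<ell> t \<and> (\<forall>i<\<ell> s. M i \<cong>\<^sub>o N i)"
  using assms
proof (induction m arbitrary: s t M N)
  case 0
  then have s: "s \<in> \<S> (Suc 0)" and t: "t \<in> \<S> (Suc 0)"
    by (simp_all add: admissible_def)
  have "M 0 \<cong>\<^sub>o N 0"
    using 0(3) dir_image_order_iso[OF inj_point(1), of "M 0"]
      order_iso_sym[OF dir_image_order_iso[OF inj_point(1), of "N 0"]]
    unfolding \<A>_single[OF s] \<A>_single[OF t] by (blast intro: order_iso_trans)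
  moreover have "\<ell> s = 1" "\<ell> t = 1"
    using leaves_singleton s t by (simp_all add: num_leaves_def)
  ultimately show ?case
    by simp
next
  case (Suc m)
  note adm = Suc.prems(1,2)
  have s: "s \<in> \<S> (Suc (Suc m))" and t: "t \<in> \<S> (Suc (Suc m))"
    using adm by (simp_all add: admissible_def)
  note A = chain_\<A>[OF adm(1)] and B = chain_\<A>[OF adm(2)]
  obtain f where f: "bij_betw f (Field (\<A> s M)) (Field (\<A> t N))"
    "\<And>x y. x \<in> Field (\<A> s M) \<Longrightarrow> y \<in> Field (\<A> s M) \<Longrightarrow>
      (x, y) \<in> \<A> s M \<longleftrightarrow> (f x, f y) \<in> \<A> t N"
    using Suc.prems(3) unfolding order_iso_iff by blast
  have fB: "f x \<in> Field (\<A> t N)" if "x \<in> Field (\<A> s M)" for x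
    using f(1) that by (auto simp: bij_betw_def)
  have fcls: "cls m (\<A> s M) x \<cong>\<^sub>o cls m (\<A> t N) (f x)"
    and flow: "lowest m (\<A> s M) x \<longleftrightarrow> lowest m (\<A> t N) (f x)" if "x \<in> Field (\<A> s M)" for x
    using cls_iso[OF A B f that, of m] lowest_iso[OF A B f that, of m] by simp_all
  have last: "last s = Suc m \<longleftrightarrow> last t = Suc m"
  proof -
    have "Field (\<A> t N) = f ` Field (\<A> s M)"
      using f(1) by (simp add: bij_betw_def)
    then have "(\<exists>x\<in>Field (\<A> s M). lowest m (\<A> s M) x) \<longleftrightarrow>
        (\<exists>y\<in>Field (\<A> t N). lowest m (\<A> t N) y)"
      using flow by simp
    then show ?thesis
      using lowest_exists_iff[OF adm(1)] lowest_exists_iff[OF adm(2)] by blast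
  qed
  have upper: "\<ell> (seq_minus s) = \<ell> (seq_minus t) \<and>
      (\<forall>i<\<ell> (seq_minus s). upper_leaves s M i \<cong>\<^sub>o upper_leaves t N i)"
  proof (rule Suc.IH[OF admissible_upper[OF adm(1)] admissible_upper[OF adm(2)]])
    obtain x y where "x \<in> Field (\<A> s M)" "(x, y) \<in> \<A> s M" "(x, y) \<notin> wcond m (\<A> s M)"
      using \<A>_nonempty[OF adm(1)] higher_point[OF adm(1)] by blast
    then have y: "y \<in> Field (\<A> s M)" "\<not> lowest m (\<A> s M) y"
      by (auto intro: FieldI2 dest: not_lowest)
    show "\<A> (seq_minus s) (upper_leaves s M) \<cong>\<^sub>o \<A> (seq_minus t) (upper_leaves t N)"
      using order_iso_trans[OF order_iso_sym[OF upper_class[OF adm(1) y]]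
          order_iso_trans[OF fcls[OF y(1)] upper_class[OF adm(2) fB[OF y(1)]]]]
        flow[OF y(1)] y(2) by blast
  qed
  show ?case
  proof (cases "last s = Suc m")
    case True
    then show ?thesis
      using upper last num_leaves_eq[OF s] num_leaves_eq[OF t] upper_leaves_eq[OF adm(1)]
        upper_leaves_eq[OF adm(2)] by simp
  next
    case False
    then have False': "last t \<noteq> Suc m"
      using last by simp
    have lower: "\<ell> (seq_plus s) = \<ell> (seq_plus t) \<and> (\<forall>i<\<ell> (seq_plus s). M i \<cong>\<^sub>o N i)"
    proof (rule Suc.IH[OF admissible_plus[OF adm(1) False] admissible_plus[OF adm(2) False']])
      obtain x where x: "x \<in> Field (\<A> s M)" "lowest m (\<A> s M) x"
        using \<A>_classes_neq(3)[OF adm(1) False] by blast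
      show "\<A> (seq_plus s) M \<cong>\<^sub>o \<A> (seq_plus t) N"
        using order_iso_trans[OF order_iso_sym[OF \<A>_classes_neq(1)[OF adm(1) False x]]
            order_iso_trans[OF fcls[OF x(1)] \<A>_classes_neq(1)[OF adm(2) False' fB[OF x(1)]]]]
          flow[OF x(1)] x(2) by blast
    qed
    have eq: "\<ell> s = \<ell> t"
      using lower upper num_leaves_neq[OF s False] num_leaves_neq[OF t False'] by simp
    have "M i \<cong>\<^sub>o N i" if i: "i < \<ell> s" for i
    proof (cases "i < \<ell> (seq_plus s)")
      case False
      then obtain j where "i = \<ell> (seq_plus s) + j"
        using le_Suc_ex not_less by blast
      then show ?thesis
        using upper lower i num_leaves_neq[OF s \<open>last s \<noteq> Suc m\<close>] \<open>last s \<noteq> Suc m\<close> False'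
          upper_leaves_eq[OF adm(1)] upper_leaves_eq[OF adm(2)] by simp
    qed (use lower in simp)
    with eq show ?thesis
      by blast
  qed
qed


section \<open>Tails\<close>

lemma cls_tail_self:
  assumes A: "chain A" and x: "x \<in> Field A"
  shows "cls m (tail A x) x = tail (cls m A x) x"
proof -
  note E = convex_equivD[OF convex_equiv_wcond[OF A]]
  have xin: "x \<in> Field (tail A x)"
    using A x by (simp add: Field_tail above_def chain_refl)
  have "(x, z) \<in> wcond m (tail A x) \<longleftrightarrow> (x, z) \<in> wcond m A \<and> z \<in> above A x" for z
    using wcond_convex_embedding[OF chain_tail[OF A] A convex_embedding_tail[OF A] xin, of z m]
      convex_equivD(2)[OF convex_equiv_wcond[OF chain_tail[OF A]], of x z m x]
    by (auto simp: Field_tail[OF A])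
  then have "wcond m (tail A x) `` {x} = wcond m A `` {x} \<inter> above A x"
    by blast
  moreover have "above (cls m A x) x = wcond m A `` {x} \<inter> above A x"
    using E(3)[OF x] by (auto simp: above_def cls_def)
  ultimately show ?thesis
    unfolding cls_def[of m "tail A x"] tail_def[of "cls m A x"]
    by (auto simp: tail_def cls_def)
qed

lemma cls_tail_higher:
  assumes A: "chain A" and xz: "(x, z) \<in> A" and nz: "(x, z) \<notin> wcond m A"
  shows "cls m (tail A x) z = cls m A z"
proof -
  note E = convex_equivD[OF convex_equiv_wcond[OF A]]
  have zin: "z \<in> Field (tail A x)"
    using A xz by (simp add: Field_tail above_def)
  have above: "w \<in> above A x" if "(z, w) \<in> wcond m A" for w
  proof (rule ccontr)
    assume "w \<notin> above A x"
    then have "(w, x) \<in> A"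
      using chain_linear[OF A FieldI1[OF xz] E(2)[OF that]] by (simp add: above_def)
    then have "(x, z) \<in> wcond m A"
      using convex_equiv_right[OF convex_equiv_wcond[OF A] _ xz] E(4)[OF that] by blast
    with nz show False ..
  qed
  have "(z, w) \<in> wcond m (tail A x) \<longleftrightarrow> (z, w) \<in> wcond m A" for w
    using wcond_convex_embedding[OF chain_tail[OF A] A convex_embedding_tail[OF A] zin, of w m]
      convex_equivD(2)[OF convex_equiv_wcond[OF chain_tail[OF A]], of z w m x] above[of w]
    by (auto simp: Field_tail[OF A])
  then have "wcond m (tail A x) `` {z} = wcond m A `` {z}"
    by blast
  then show ?thesis
    using above by (auto simp: cls_def tail_def)
qed

lemma tail_iso_classes:
  assumes A: "chain A" and B: "chain B" and x: "x \<in> Field A" and y: "y \<in> Field B"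
    and iso: "tail A x \<cong>\<^sub>o tail B y"
  shows tail_iso_tail_cls: "tail (cls m A x) x \<cong>\<^sub>o tail (cls m B y) y"
    and tail_iso_higher_cls: "(x, z) \<in> A \<Longrightarrow> (x, z) \<notin> wcond m A \<Longrightarrow>
      \<exists>w. (y, w) \<in> B \<and> (y, w) \<notin> wcond m B \<and> cls m A z \<cong>\<^sub>o cls m B w"
proof -
  note TA = chain_tail[OF A, of x] and TB = chain_tail[OF B, of y]
  obtain f where f: "bij_betw f (Field (tail A x)) (Field (tail B y))"
    "\<And>u v. u \<in> Field (tail A x) \<Longrightarrow> v \<in> Field (tail A x) \<Longrightarrow>
      (u, v) \<in> tail A x \<longleftrightarrow> (f u, f v) \<in> tail B y"
    using iso unfolding order_iso_iff by blast
  have fx: "f x = y"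
    by (rule tail_iso_min[OF A B x y f])
  have xin: "x \<in> Field (tail A x)"
    using A x by (simp add: Field_tail above_def chain_refl)
  show "tail (cls m A x) x \<cong>\<^sub>o tail (cls m B y) y"
    using cls_iso[OF TA TB f xin, of m] cls_tail_self[OF A x] cls_tail_self[OF B y]
    by (simp add: fx)
  assume z: "(x, z) \<in> A" "(x, z) \<notin> wcond m A"
  have zin: "z \<in> Field (tail A x)"
    using A z by (simp add: Field_tail above_def)
  then have fzin: "f z \<in> Field (tail B y)"
    using f(1) by (auto simp: bij_betw_def)
  have yin: "y \<in> Field (tail B y)"
    using B y by (simp add: Field_tail above_def chain_refl)
  have "(y, f z) \<in> B"
    using fzin by (simp add: Field_tail[OF B] above_def)
  moreover have "(y, f z) \<notin> wcond m B"
    using wcond_convex_embedding[OF TA A convex_embedding_tail[OF A] xin zin, of m]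
      wcond_convex_embedding[OF TA TB convex_embedding_of_iso[OF f] xin zin, of m]
      wcond_convex_embedding[OF TB B convex_embedding_tail[OF B] yin fzin, of m] z(2)
    by (simp add: fx)
  ultimately show "\<exists>w. (y, w) \<in> B \<and> (y, w) \<notin> wcond m B \<and> cls m A z \<cong>\<^sub>o cls m B w"
    using cls_iso[OF TA TB f zin, of m] cls_tail_higher[OF A z] cls_tail_higher[OF B, of y "f z" m]
    by auto
qed

text \<open>Every tail of one chain is isomorphic to every tail of the other; for uniform nonempty chains
  this says that their common tails are isomorphic.\<close>

definition same_tails :: "'a rel \<Rightarrow> 'b rel \<Rightarrow> bool" where
  "same_tails A B \<longleftrightarrow> (\<forall>x\<in>Field A. \<forall>y\<in>Field B. tail A x \<cong>\<^sub>o tail B y)"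

lemma iso_tail_exists:
  assumes "chain A" "chain C" "A \<cong>\<^sub>o C" "p \<in> Field C"
  shows "\<exists>x\<in>Field A. tail A x \<cong>\<^sub>o tail C p"
proof -
  obtain f where f: "bij_betw f (Field A) (Field C)"
    "\<And>x y. x \<in> Field A \<Longrightarrow> y \<in> Field A \<Longrightarrow> (x, y) \<in> A \<longleftrightarrow> (f x, f y) \<in> C"
    using assms(3) unfolding order_iso_iff by blast
  obtain x where "x \<in> Field A" "p = f x"
    using f(1) assms(4) unfolding bij_betw_def by blast
  then show ?thesis
    using tail_order_iso[OF assms(1,2) f] by blast
qed

lemma same_tails_iso:
  assumes "chain A" "chain B" "chain C" "chain D" "A \<cong>\<^sub>o C" "B \<cong>\<^sub>o D" "same_tails A B"
  shows "same_tails C D"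
  unfolding same_tails_def
proof (intro ballI)
  fix p q assume "p \<in> Field C" "q \<in> Field D"
  then obtain x y where x: "x \<in> Field A" "tail A x \<cong>\<^sub>o tail C p"
    and y: "y \<in> Field B" "tail B y \<cong>\<^sub>o tail D q"
    using iso_tail_exists[OF assms(1,3,5)] iso_tail_exists[OF assms(2,4,6)] by blast
  have "tail A x \<cong>\<^sub>o tail B y"
    using assms(7) x(1) y(1) by (simp add: same_tails_def)
  then show "tail C p \<cong>\<^sub>o tail D q"
    by (rule order_iso_trans[OF order_iso_sym[OF x(2)] order_iso_trans[OF _ y(2)]])
qed

lemma same_tails_cls:
  assumes A: "chain A" and B: "chain B" and same: "same_tails A B"
  shows "same_tails (cls m A x) (cls m B y)"
  unfolding same_tails_def Field_cls[OF A] Field_cls[OF B]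
proof (intro ballI)
  note EA = convex_equiv_wcond[OF A, of m] and EB = convex_equiv_wcond[OF B, of m]
  fix u v assume u: "u \<in> wcond m A `` {x}" and v: "v \<in> wcond m B `` {y}"
  have "u \<in> Field A" "x \<in> Field A"
    using u convex_equivD(1,2)[OF EA] by blast+
  then have cu: "cls m A x = cls m A u"
    using u convex_equiv_class_eq_iff[OF EA, of x u] by (simp add: cls_def)
  have "v \<in> Field B" "y \<in> Field B"
    using v convex_equivD(1,2)[OF EB] by blast+
  then have cv: "cls m B y = cls m B v"
    using v convex_equiv_class_eq_iff[OF EB, of y v] by (simp add: cls_def)
  show "tail (cls m A x) u \<cong>\<^sub>o tail (cls m B y) v"
    unfolding cu cv
    using tail_iso_tail_cls[OF A B \<open>u \<in> Field A\<close> \<open>v \<in> Field B\<close>] same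
      \<open>u \<in> Field A\<close> \<open>v \<in> Field B\<close> by (simp add: same_tails_def)
qed


section \<open>Weights\<close>

text \<open>The weight of a leaf is the number of left steps with which its path from the root ends. It
  equals the depth of the tree only if all steps are left steps, so only for the first leaf, and only
  the weight of such a leaf depends on the number in the root label.\<close>

lemma weight_of_leaf:
  assumes "t \<in> \<S> (Suc j)" "i < \<ell> t"
  shows "wt t i \<le> j \<and> (wt t i = j \<longrightarrow> i = 0) \<and>
    snd (descend j [(t, k)] ! i) = (if wt t i = j then k + j else wt t i)"
  using assms
proof (induction j arbitrary: t i k)
  case 0
  then show ?case
    using leaves_singleton[of t] by (simp add: num_leaves_def wt_def)
next
  case (Suc j)
  then have len: "length t = Suc (Suc j)"
    by (simp add: \<S>_def)
  have minus: "seq_minus t \<in> \<S> (Suc j)" "length (seq_minus t) = Suc j"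
    using Suc.prems(1) seq_minus_in by (auto simp: seq_minus_def \<S>_def)
  have wt_eq: "wt t i = snd (descend (Suc j) [(t, 0)] ! i)"
    by (simp add: wt_def leaves_def tree_level_def len)
  have wt_minus: "wt (seq_minus t) i' = snd (descend j [(seq_minus t, 0)] ! i')" for i'
    by (simp add: wt_def leaves_def tree_level_def minus(2))
  have ell_minus: "\<ell> (seq_minus t) = length (descend j [(seq_minus t, 0)])"
    by (simp add: num_leaves_def leaves_def tree_level_def minus(2))
  show ?case
  proof (cases "last t = Suc j")
    case True
    then have d: "descend (Suc j) [(t, k)] = descend j [(seq_minus t, 0)]" for k
      by (simp add: len)
    have "i < \<ell> (seq_minus t)"
      using Suc.prems(2) num_leaves_eq[OF Suc.prems(1) True] by simp
    then have "wt (seq_minus t) i \<le> j"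
      using Suc.IH[OF minus(1)] by blast
    then show ?thesis
      unfolding wt_eq d wt_minus[symmetric] by simp
  next
    case False
    have plus: "seq_plus t \<in> \<S> (Suc j)"
      by (rule seq_plus_in[OF Suc.prems(1) False])
    have d: "descend (Suc j) [(t, k)] =
        descend j [(seq_plus t, k + 1)] @ descend j [(seq_minus t, 0)]" for k
      using False len descend_append[of j "[(seq_plus t, k + 1)]" "[(seq_minus t, 0)]"] by simp
    have len_plus: "length (descend j [(seq_plus t, k)]) = \<ell> (seq_plus t)" for k
    proof -
      have "length (seq_plus t) = Suc j"
        using plus by (simp add: \<S>_def)
      then show ?thesis
        using arg_cong[OF fst_descend_cong[of "[(seq_plus t, k)]" "[(seq_plus t, 0)]" j], of length]
        by (simp add: num_leaves_def leaves_def tree_level_def)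
    qed
    show ?thesis
    proof (cases "i < \<ell> (seq_plus t)")
      case True
      then have "snd (descend (Suc j) [(t, k)] ! i) =
          (if wt (seq_plus t) i = j then k + Suc j else wt (seq_plus t) i)" for k
        unfolding d using Suc.IH[OF plus True, of "k + 1"] by (simp add: nth_append len_plus)
      moreover have "wt (seq_plus t) i \<le> j" "wt (seq_plus t) i = j \<longrightarrow> i = 0"
        using Suc.IH[OF plus True] by blast+
      ultimately show ?thesis
        unfolding wt_eq by simp
    next
      case False
      let ?i = "i - \<ell> (seq_plus t)"
      have i: "?i < \<ell> (seq_minus t)"
        using False Suc.prems(2) num_leaves_neq[OF Suc.prems(1) \<open>last t \<noteq> Suc j\<close>] by simp
      have "snd (descend (Suc j) [(t, k)] ! i) = wt (seq_minus t) ?i" for k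
        unfolding d wt_minus using False by (simp add: nth_append len_plus)
      moreover have "wt (seq_minus t) ?i \<le> j"
        using Suc.IH[OF minus(1) i] by blast
      ultimately show ?thesis
        unfolding wt_eq by simp
    qed
  qed
qed

lemma weight_le: "t \<in> \<S> (Suc j) \<Longrightarrow> i < \<ell> t \<Longrightarrow> wt t i \<le> j"
  and weight_eq_depth: "t \<in> \<S> (Suc j) \<Longrightarrow> i < \<ell> t \<Longrightarrow> wt t i = j \<Longrightarrow> i = 0"
  using weight_of_leaf by blast+

lemma weight_eq_minus:
  assumes "s \<in> \<S> (Suc (Suc m))" "last s = Suc m"
  shows "wt s i = wt (seq_minus s) i"
  using leaves_eq[OF assms(1)] last_in_\<S>[OF assms(1)] assms(2) by (simp add: wt_def)

lemma weight_plus: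
  assumes "s \<in> \<S> (Suc (Suc m))" "last s \<noteq> Suc m" "i < \<ell> (seq_plus s)"
  shows "wt s i = (if wt (seq_plus s) i = m then Suc m else wt (seq_plus s) i)"
proof -
  have less: "s ! Suc m < Suc m"
    using last_in_\<S>[OF assms(1)] assms(2) by simp
  note l = leaves_less[OF assms(1) _ less, simplified]
  have "length (descend m [(seq_plus s, 1)]) = \<ell> (seq_plus s)"
    using arg_cong[OF l(2), of length] by (simp add: num_leaves_def)
  then have "wt s i = snd (descend m [(seq_plus s, 1)] ! i)"
    using assms(3) by (simp add: wt_def l(1) nth_append)
  then show ?thesis
    using weight_of_leaf[OF seq_plus_in[OF assms(1,2)] assms(3), of 1] by simp
qed

lemma weight_minus:
  assumes "s \<in> \<S> (Suc (Suc m))" "last s \<noteq> Suc m"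
  shows "wt s (\<ell> (seq_plus s) + i) = wt (seq_minus s) i"
proof -
  have less: "s ! Suc m < Suc m"
    using last_in_\<S>[OF assms(1)] assms(2) by simp
  note l = leaves_less[OF assms(1) _ less, simplified]
  have "length (descend m [(seq_plus s, 1)]) = \<ell> (seq_plus s)"
    using arg_cong[OF l(2), of length] by (simp add: num_leaves_def)
  then show ?thesis
    by (simp add: wt_def l(1) nth_append)
qed


section \<open>Comparing leaves\<close>

text \<open>Each leaf of \<open>s\<close> is a leaf of a sequence \<open>u\<close> one shorter whose chain occurs as a class of
  \<open>\<A>(s)\<close>. The weights in \<open>s\<close> and \<open>u\<close> agree unless all steps to the leaf are left steps, and a leaf
  of weight \<open>|s| - 2\<close> is the first leaf of \<open>s\<^sup>-\<close>.\<close>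

lemma leaf_of_class:
  assumes adm: "admissible (Suc m) s M" and i: "i < \<ell> s"
  obtains u K j x where "admissible m u K" "j < \<ell> u" "K j = M i" "x \<in> Field (\<A> s M)"
    "cls m (\<A> s M) x \<cong>\<^sub>o \<A> u K"
    "wt s i \<le> m \<Longrightarrow> wt u j = wt s i"
    "wt s i = m \<Longrightarrow> u = seq_minus s \<and> K = upper_leaves s M \<and> j = 0"
proof -
  have s: "s \<in> \<S> (Suc (Suc m))"
    using adm by (simp add: admissible_def)
  have minus: "seq_minus s \<in> \<S> (Suc m)"
    by (rule seq_minus_in[OF s])
  obtain y where y: "y \<in> Field (\<A> s M)" "\<not> lowest m (\<A> s M) y"
    using \<A>_nonempty[OF adm] higher_point[OF adm] not_lowest FieldI2 by (metis ex_in_conv)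
  note up = admissible_upper[OF adm] and cup = upper_class[OF adm y]
  show ?thesis
  proof (cases "last s = Suc m")
    case True
    have "upper_leaves s M = M"
      using True upper_leaves_eq[OF adm] by simp
    then show ?thesis
      using that[OF up _ _ y(1) cup, of i] i num_leaves_eq[OF s True] weight_eq_minus[OF s True, of i]
        weight_eq_depth[OF minus, of i] by simp
  next
    case False
    show ?thesis
    proof (cases "i < \<ell> (seq_plus s)")
      case True
      obtain x where x: "x \<in> Field (\<A> s M)" "lowest m (\<A> s M) x"
        using \<A>_classes_neq(3)[OF adm False] by blast
      note w = weight_plus[OF s False True] weight_le[OF seq_plus_in[OF s False] True]
      show ?thesis
      proof (rule that[OF admissible_plus[OF adm False] True refl x(1)
              \<A>_classes_neq(1)[OF adm False x]])
        show "wt (seq_plus s) i = wt s i" if "wt s i \<le> m"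
          using that w by (simp split: if_splits)
        show "seq_plus s = seq_minus s \<and> M = upper_leaves s M \<and> i = 0" if "wt s i = m"
          using that w by (simp split: if_splits)
      qed
    next
      case ge: False
      have K: "upper_leaves s M = right_part s M"
        using False upper_leaves_eq[OF adm] by simp
      define j where "j = i - \<ell> (seq_plus s)"
      have j: "i = \<ell> (seq_plus s) + j" "j < \<ell> (seq_minus s)"
        using ge i num_leaves_neq[OF s False] by (auto simp: j_def)
      note w = weight_minus[OF s False, of j, folded j(1)]
      show ?thesis
      proof (rule that[OF up j(2) _ y(1) cup])
        show "upper_leaves s M j = M i"
          using K j(1) by simp
        show "wt (seq_minus s) j = wt s i"
          by (rule w[symmetric])
        show "seq_minus s = seq_minus s \<and> upper_leaves s M = upper_leaves s M \<and> j = 0"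
          if "wt s i = m"
          using weight_eq_depth[OF minus j(2)] w that by simp
      qed
    qed
  qed
qed

text \<open>The induction hypothesis applies to each pair of a class of \<open>\<A>(s)\<close> and a class of \<open>\<A>(t)\<close>. It
  misses only the pairs of leaves of weight \<open>m\<close>, which are first leaves of \<open>s\<^sup>-\<close> and \<open>t\<^sup>-\<close>; these are
  covered because \<open>\<A>(s\<^sup>-)\<close> and \<open>\<A>(t\<^sup>-)\<close> themselves, and not only their tails, are isomorphic.\<close>

lemma same_tails_leaves:
  assumes "admissible m s M" "admissible m t N" "same_tails (\<A> s M) (\<A> t N)"
    and "i < \<ell> s" "j < \<ell> t"
  shows "same_tails (M i) (N j) \<and> (wt s i = wt t j \<longrightarrow> wt s i < m \<longrightarrow> M i \<cong>\<^sub>o N j)"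
  using assms
proof (induction m arbitrary: s t M N i j)
  case 0
  then have s: "s \<in> \<S> (Suc 0)" and t: "t \<in> \<S> (Suc 0)"
    by (simp_all add: admissible_def)
  have ij: "i = 0" "j = 0"
    using 0(4,5) leaves_singleton s t by (simp_all add: num_leaves_def)
  have M: "chain (M 0)" "chain (N 0)"
    using 0(1,2,4,5) ij by (auto simp: admissible_def)
  have "same_tails (M 0) (N 0)"
    by (rule same_tails_iso[OF chain_\<A>[OF 0(1)] chain_\<A>[OF 0(2)] M _ _ 0(3)])
      (simp_all add: \<A>_single s t order_iso_sym[OF dir_image_order_iso[OF inj_point(1)]])
  then show ?case
    by (simp add: ij)
next
  case (Suc m)
  note adm = Suc.prems(1,2)
  note A = chain_\<A>[OF adm(1)] and B = chain_\<A>[OF adm(2)]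
  obtain u K i' x where u: "admissible m u K" "i' < \<ell> u" "K i' = M i" "x \<in> Field (\<A> s M)"
    "cls m (\<A> s M) x \<cong>\<^sub>o \<A> u K" "wt s i \<le> m \<Longrightarrow> wt u i' = wt s i"
    "wt s i = m \<Longrightarrow> u = seq_minus s \<and> K = upper_leaves s M \<and> i' = 0"
    using leaf_of_class[OF adm(1) Suc.prems(4)] by blast
  obtain v L j' y where v: "admissible m v L" "j' < \<ell> v" "L j' = N j" "y \<in> Field (\<A> t N)"
    "cls m (\<A> t N) y \<cong>\<^sub>o \<A> v L" "wt t j \<le> m \<Longrightarrow> wt v j' = wt t j"
    "wt t j = m \<Longrightarrow> v = seq_minus t \<and> L = upper_leaves t N \<and> j' = 0"
    using leaf_of_class[OF adm(2) Suc.prems(5)] by blast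
  have "same_tails (\<A> u K) (\<A> v L)"
    by (rule same_tails_iso[OF chain_cls[OF A] chain_cls[OF B] chain_\<A>[OF u(1)] chain_\<A>[OF v(1)]
          u(5) v(5) same_tails_cls[OF A B Suc.prems(3)]])
  note IH = Suc.IH[OF u(1) v(1) this u(2) v(2)]
  have "M i \<cong>\<^sub>o N j" if wt: "wt s i = wt t j" "wt s i < Suc m"
  proof (cases "wt s i = m")
    case False
    then show ?thesis
      using IH wt u(3,6) v(3,6) by simp
  next
    case True
    obtain z where z: "(x, z) \<in> \<A> s M" "(x, z) \<notin> wcond m (\<A> s M)"
      using higher_point[OF adm(1) u(4)] by blast
    have "tail (\<A> s M) x \<cong>\<^sub>o tail (\<A> t N) y"
      using Suc.prems(3) u(4) v(4) by (simp add: same_tails_def)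
    then obtain w where w: "(y, w) \<in> \<A> t N" "(y, w) \<notin> wcond m (\<A> t N)"
      "cls m (\<A> s M) z \<cong>\<^sub>o cls m (\<A> t N) w"
      using tail_iso_higher_cls[OF A B u(4) v(4) _ z] by blast
    have "\<A> (seq_minus s) (upper_leaves s M) \<cong>\<^sub>o \<A> (seq_minus t) (upper_leaves t N)"
      using order_iso_trans[OF order_iso_sym[OF upper_class[OF adm(1) FieldI2[OF z(1)] not_lowest[OF z]]]
          order_iso_trans[OF w(3) upper_class[OF adm(2) FieldI2[OF w(1)] not_lowest[OF w(1,2)]]]] .
    then have "\<forall>i<\<ell> (seq_minus s). upper_leaves s M i \<cong>\<^sub>o upper_leaves t N i"
      using \<A>_iso_imp_leaves_iso[OF admissible_upper[OF adm(1)] admissible_upper[OF adm(2)]] by blast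
    then show ?thesis
      using u(2,3) u(7)[OF True] v(3) v(7) True wt(1) by auto
  qed
  with IH u(3) v(3) show ?case
    by auto
qed

theorem mainTheorem2:
  fixes s :: "nat list" and n :: nat and M :: "nat \<Rightarrow> 'a rel"
  assumes "s \<in> \<S> (n + 1)"
    and "\<And>i. i < \<ell> s \<Longrightarrow> chain (M i) \<and> uniform (M i) \<and> has_rank_omega (M i)"
    and "uniform (\<A> s M)"
  shows "(\<forall>i<\<ell> s. \<forall>j<\<ell> s. common_tail (M i) \<cong>\<^sub>o common_tail (M j)) \<and>
         (\<forall>i<\<ell> s. \<forall>j<\<ell> s. wt s i = wt s j \<longrightarrow> M i \<cong>\<^sub>o M j)"
proof -
  have s: "s \<in> \<S> (Suc n)"
    using assms(1) by simp
  have adm: "admissible n s M"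
    using s assms(2) by (simp add: admissible_def)
  have "same_tails (\<A> s M) (\<A> s M)"
    using assms(3) by (simp add: same_tails_def uniform_def)
  note leaves = same_tails_leaves[OF adm adm this]
  have "common_tail (M i) \<cong>\<^sub>o common_tail (M j)" if ij: "i < \<ell> s" "j < \<ell> s" for i j
  proof -
    have ne: "(SOME x. x \<in> Field (M k)) \<in> Field (M k)" if "k < \<ell> s" for k
      using rank_omegaD(1)[of "M k"] assms(2)[OF that] by (simp add: some_in_eq)
    show ?thesis
      using leaves[OF ij] ne[OF ij(1)] ne[OF ij(2)] by (simp add: same_tails_def common_tail_def)
  qed
  moreover have "M i \<cong>\<^sub>o M j" if ij: "i < \<ell> s" "j < \<ell> s" and wt: "wt s i = wt s j" for i j
  proof (cases "wt s i = n")
    case True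
    \<comment> \<open>only the first leaf has this weight\<close>
    then have "i = j"
      using weight_eq_depth[OF s ij(1)] weight_eq_depth[OF s ij(2)] wt by simp
    then show ?thesis
      by (simp add: order_iso_refl)
  next
    case False
    then show ?thesis
      using leaves[OF ij] wt weight_le[OF s ij(1)] by simp
  qed
  ultimately show ?thesis
    by blast
qed

end
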